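(* Let $R=\bigoplus_{n\ge 0}R_n$ be a finitely generated standard graded algebra over a Noetherian commutative ring $R_0$ and let $M$ be a finitely generated graded $R$-module. Let $z_1,\ldots,z_s$ be an $M$-filter-regular sequence of linear forms (elements of $R_1$) such that $Q=(z_1,\ldots,z_s)$ is an $M$-reduction of $R_+$. Put $Q_0=0$ and $Q_i=(z_1,\ldots,z_i)$ for $i=1,\ldots,s$. Then $$\operatorname{reg}(M)=\max\{a(z_1,\ldots,z_s;M),\ a(M/QM)\}=\max\{a((Q_iM:R_+)/Q_iM)\mid i=0,\ldots,s\}.$$
   Context: Standard graded means $R$ is generated over $R_0$ by $R_1$; $R_+=\bigoplus_{n\ge1}R_n$. For a graded $R$-module $H$, $a(H)=\sup\{t\mid H_t\ne0\}$, with $a(0)=-\infty$. $H^i_{R_+}(M)$ is the $i$-th (graded) local cohomology module of $M$ with respect to $R_+$, $a_i(M)=a(H^i_{R_+}(M))$, and $\operatorname{reg}(M)=\max\{a_i(M)+i\mid i\ge0\}$. A homogeneous element $z\in R$ is $M$-filter-regular if $(0_M:z)_t=0$ for $t\gg0$, where $0_M:z=\{e\in M\mid ze=0\}$. A sequence of homogeneous elements $z_1,\ldots,z_s$ is an $M$-filter-regular sequence if $z_{i+1}$ is $M/Q_iM$-filter-regular for $i=0,\ldots,s-1$. One sets $a(z_1,\ldots,z_s;M)=\max\{a((Q_iM:z_{i+1})/Q_iM)\mid i=0,\ldots,s-1\}$. Here $Q_iM:z=\{e\in M\mid ze\in Q_iM\}$ and $Q_iM:R_+=\{e\in M\mid R_+e\subseteq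 Q_iM\}$. A homogeneous ideal $Q\subseteq R_+$ is an $M$-reduction of $R_+$ if $Q$ is generated by linear forms and $(M/QM)_t=0$ for $t\gg0$. The maximum of the empty set is $-\infty$. *)

theory Defs
  imports
    "HOL-Library.Extended_Real"
    "HOL-Library.FuncSet"
    "HOL-Algebra.Generated_Rings"
    "HOL-Algebra.Algebraic_Closure_Type"
begin

section \<open>Graded rings and modules\<close>

definition sum_of_family :: "('i \<Rightarrow> 'a::ab_group_add set) \<Rightarrow> 'i set \<Rightarrow> 'a set" where
  "sum_of_family S I = {(\<Sum>i\<in>A. f i) | A f. finite A \<and> A \<subseteq> I \<and> (\<forall>i\<in>A. f i \<in> S i)}"

definition is_grading :: "('i \<Rightarrow> 'a::ab_group_add set) \<Rightarrow> bool" where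
  "is_grading S \<longleftrightarrow>
     (\<forall>i. 0 \<in> S i \<and> (\<forall>a\<in>S i. \<forall>b\<in>S i. a - b \<in> S i)) \<and>
     sum_of_family S UNIV = UNIV \<and>
     (\<forall>A f. finite A \<longrightarrow> (\<forall>i\<in>A. f i \<in> S i) \<longrightarrow> (\<Sum>i\<in>A. f i) = 0 \<longrightarrow> (\<forall>i\<in>A. f i = 0))"

locale graded_ring =
  fixes R :: "nat \<Rightarrow> 'r::comm_ring_1 set"
  assumes grading: "is_grading R"
    and one_mem: "1 \<in> R 0"
    and mult_mem: "a \<in> R m \<Longrightarrow> b \<in> R n \<Longrightarrow> a * b \<in> R (m + n)"

definition noetherian_degree_zero :: "(nat \<Rightarrow> 'r::comm_ring_1 set) \<Rightarrow> bool" where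
  "noetherian_degree_zero R \<longleftrightarrow> noetherian_ring (ring_of_type_algebra\<lparr>carrier := R 0\<rparr>)"

definition fin_gen_algebra :: "(nat \<Rightarrow> 'r::comm_ring_1 set) \<Rightarrow> bool" where
  "fin_gen_algebra R \<longleftrightarrow>
     (\<exists>F. finite F \<and> generate_ring ring_of_type_algebra (R 0 \<union> F) = UNIV)"

definition standard_graded :: "(nat \<Rightarrow> 'r::comm_ring_1 set) \<Rightarrow> bool" where
  "standard_graded R \<longleftrightarrow> generate_ring ring_of_type_algebra (R 0 \<union> R 1) = UNIV"

definition irrelevant_ideal :: "(nat \<Rightarrow> 'r::comm_ring_1 set) \<Rightarrow> 'r set" where
  "irrelevant_ideal R = sum_of_family R {1..}"

locale graded_module = graded_ring R + Modules.module scale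
  for R :: "nat \<Rightarrow> 'r::comm_ring_1 set"
    and scale :: "'r \<Rightarrow> 'm::ab_group_add \<Rightarrow> 'm"
    and M :: "int \<Rightarrow> 'm set" +
  assumes module_grading: "is_grading M"
    and scale_mem: "a \<in> R n \<Longrightarrow> m \<in> M t \<Longrightarrow> scale a m \<in> M (int n + t)"

definition fin_gen_module :: "('r::comm_ring_1 \<Rightarrow> 'm::ab_group_add \<Rightarrow> 'm) \<Rightarrow> bool" where
  "fin_gen_module scale \<longleftrightarrow> (\<exists>F. finite F \<and> module.span scale F = UNIV)"

text \<open>
  A graded subquotient \<open>U/V\<close> is given by the components \<open>U t\<close> and \<open>V t\<close>, with \<open>V t \<subseteq> U t\<close>;
  its component of degree \<open>t\<close> is \<open>U t / V t\<close>, which is nonzero iff \<open>U t \<noteq> V t\<close>.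
  The supremum is taken in the extended reals, so that it is \<open>-\<infinity>\<close> for the zero module.
\<close>

definition a_inv :: "(int \<Rightarrow> 'x set) \<Rightarrow> (int \<Rightarrow> 'x set) \<Rightarrow> ereal" where
  "a_inv U V = (SUP t\<in>{t. U t \<noteq> V t}. ereal (real_of_int t))"

text \<open>For submodules \<open>N \<subseteq> L\<close> of \<open>M\<close>: the invariant \<open>a(L/N)\<close>.\<close>

definition a_quot :: "(int \<Rightarrow> 'm set) \<Rightarrow> 'm set \<Rightarrow> 'm set \<Rightarrow> ereal" where
  "a_quot M L N = a_inv (\<lambda>t. L \<inter> M t) (\<lambda>t. N \<inter> M t)"


section \<open>Ideals, filter-regular sequences, reductions\<close>

definition ideal_gen :: "'r::comm_ring_1 set \<Rightarrow> 'r set" where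
  "ideal_gen S = module.span (*) S"

definition ideal_mult :: "('r::comm_ring_1 \<Rightarrow> 'm::ab_group_add \<Rightarrow> 'm) \<Rightarrow> 'r set \<Rightarrow> 'm set" where
  "ideal_mult scale Q = module.span scale {scale q m | q m. q \<in> Q}"

definition colon_elem :: "('r \<Rightarrow> 'm \<Rightarrow> 'm) \<Rightarrow> 'm set \<Rightarrow> 'r \<Rightarrow> 'm set" where
  "colon_elem scale N z = {e. scale z e \<in> N}"

definition colon_ideal :: "('r \<Rightarrow> 'm \<Rightarrow> 'm) \<Rightarrow> 'm set \<Rightarrow> 'r set \<Rightarrow> 'm set" where
  "colon_ideal scale N J = {e. \<forall>r\<in>J. scale r e \<in> N}"

text \<open>
  \<open>z\<close> is filter-regular on \<open>M/N\<close>: the annihilator of \<open>z\<close> in \<open>M/N\<close> is \<open>(N : z)/N\<close>, and it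
  vanishes in all large degrees.
\<close>

definition filter_regular_quot ::
  "(nat \<Rightarrow> 'r set) \<Rightarrow> ('r \<Rightarrow> 'm \<Rightarrow> 'm) \<Rightarrow> (int \<Rightarrow> 'm set) \<Rightarrow> 'm set \<Rightarrow> 'r \<Rightarrow> bool" where
  "filter_regular_quot R scale M N z \<longleftrightarrow>
     (\<exists>n. z \<in> R n) \<and> (\<exists>t0. \<forall>t\<ge>t0. colon_elem scale N z \<inter> M t = N \<inter> M t)"

definition QM ::
  "('r::comm_ring_1 \<Rightarrow> 'm::ab_group_add \<Rightarrow> 'm) \<Rightarrow> (nat \<Rightarrow> 'r) \<Rightarrow> nat \<Rightarrow> 'm set" where
  "QM scale z i = ideal_mult scale (ideal_gen (z ` {1..i}))"

definition filter_regular_seq ::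
  "(nat \<Rightarrow> 'r::comm_ring_1 set) \<Rightarrow> ('r \<Rightarrow> 'm::ab_group_add \<Rightarrow> 'm) \<Rightarrow> (int \<Rightarrow> 'm set)
     \<Rightarrow> (nat \<Rightarrow> 'r) \<Rightarrow> nat \<Rightarrow> bool" where
  "filter_regular_seq R scale M z s \<longleftrightarrow>
     (\<forall>i<s. filter_regular_quot R scale M (QM scale z i) (z (i + 1)))"

definition a_seq ::
  "('r::comm_ring_1 \<Rightarrow> 'm::ab_group_add \<Rightarrow> 'm) \<Rightarrow> (int \<Rightarrow> 'm set) \<Rightarrow> (nat \<Rightarrow> 'r) \<Rightarrow> nat \<Rightarrow> ereal"
where
  "a_seq scale M z s =
     (SUP i\<in>{..<s}. a_quot M (colon_elem scale (QM scale z i) (z (i + 1))) (QM scale z i))"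

text \<open>An ideal generated by linear forms is automatically homogeneous.\<close>

definition is_reduction ::
  "(nat \<Rightarrow> 'r::comm_ring_1 set) \<Rightarrow> ('r \<Rightarrow> 'm::ab_group_add \<Rightarrow> 'm) \<Rightarrow> (int \<Rightarrow> 'm set)
     \<Rightarrow> 'r set \<Rightarrow> bool" where
  "is_reduction R scale M Q \<longleftrightarrow>
     Q \<subseteq> irrelevant_ideal R \<and> (\<exists>L\<subseteq>R 1. Q = ideal_gen L) \<and>
     (\<exists>t0. \<forall>t\<ge>t0. M t \<subseteq> ideal_mult scale Q)"


section \<open>Localization at the powers of an element\<close>

text \<open>
  The fraction \<open>m / s ^ k\<close> is the set of all pairs \<open>(m', k')\<close> with \<open>m' / s ^ k' = m / s ^ k\<close>.
  Operations on fractions are defined on representatives; the unions below are unions of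
  families whose members all coincide.
\<close>

definition loc_frac ::
  "('r::comm_ring_1 \<Rightarrow> 'm::ab_group_add \<Rightarrow> 'm) \<Rightarrow> 'r \<Rightarrow> 'm \<Rightarrow> nat \<Rightarrow> ('m \<times> nat) set" where
  "loc_frac scale s m k =
     {(m', k'). \<exists>l. scale (s ^ l) (scale (s ^ k') m - scale (s ^ k) m') = 0}"

definition localization ::
  "('r::comm_ring_1 \<Rightarrow> 'm::ab_group_add \<Rightarrow> 'm) \<Rightarrow> 'r \<Rightarrow> ('r, ('m \<times> nat) set) module" where
  "localization scale s =
     \<lparr>carrier = {loc_frac scale s m k | m k. True},
      monoid.mult = undefined, monoid.one = undefined,
      ring.zero = loc_frac scale s 0 0,
      ring.add = (\<lambda>A B. \<Union>(m, k)\<in>A. \<Union>(n, l)\<in>B.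
               loc_frac scale s (scale (s ^ l) m + scale (s ^ k) n) (k + l)),
      module.smult = (\<lambda>r A. \<Union>(m, k)\<in>A. loc_frac scale s (scale r m) k)\<rparr>"

text \<open>The canonical map from the localization at \<open>s\<close> to the localization at \<open>s * u\<close>.\<close>

definition loc_map ::
  "('r::comm_ring_1 \<Rightarrow> 'm::ab_group_add \<Rightarrow> 'm) \<Rightarrow> 'r \<Rightarrow> 'r \<Rightarrow> ('m \<times> nat) set \<Rightarrow> ('m \<times> nat) set"
where
  "loc_map scale s u A = (\<Union>(m, k)\<in>A. loc_frac scale (s * u) (scale (u ^ k) m) k)"

text \<open>The component of degree \<open>t\<close> of the localization at an element \<open>s\<close> of degree \<open>d\<close>.\<close>

definition loc_degree ::
  "('r::comm_ring_1 \<Rightarrow> 'm::ab_group_add \<Rightarrow> 'm) \<Rightarrow> (int \<Rightarrow> 'm set) \<Rightarrow> 'r \<Rightarrow> nat \<Rightarrow> int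
     \<Rightarrow> ('m \<times> nat) set set" where
  "loc_degree scale M s d t = {loc_frac scale s m k | m k. m \<in> M (t + int k * int d)}"


section \<open>Local cohomology and regularity\<close>

text \<open>
  Graded local cohomology with respect to the ideal generated by elements
  \<open>x 0, \<dots>, x (n - 1)\<close> of degree 1 is the cohomology of the Cech complex with terms
  \<open>C^p = (\<Oplus>I. M[1 / (\<Prod>i\<in>I. x i)])\<close>, where \<open>I\<close> ranges over the
  \<open>p\<close>-element subsets of \<open>{..<n}\<close>. The differential is homogeneous of degree 0, so the
  cohomology is graded and its component of degree \<open>t\<close> is the cohomology of the component
  of degree \<open>t\<close> of the complex.
\<close>

definition cech_index :: "nat \<Rightarrow> nat \<Rightarrow> nat set set" where
  "cech_index n p = {I. I \<subseteq> {..<n} \<and> card I = p}"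

definition cech_cochains ::
  "('r::comm_ring_1 \<Rightarrow> 'm::ab_group_add \<Rightarrow> 'm) \<Rightarrow> (int \<Rightarrow> 'm set) \<Rightarrow> (nat \<Rightarrow> 'r) \<Rightarrow> nat
     \<Rightarrow> nat \<Rightarrow> int \<Rightarrow> (nat set \<Rightarrow> ('m \<times> nat) set) set" where
  "cech_cochains scale M x n p t =
     (\<Pi>\<^sub>E I\<in>cech_index n p. loc_degree scale M (\<Prod>i\<in>I. x i) p t)"

definition cech_zero ::
  "('r::comm_ring_1 \<Rightarrow> 'm::ab_group_add \<Rightarrow> 'm) \<Rightarrow> (nat \<Rightarrow> 'r) \<Rightarrow> nat \<Rightarrow> nat
     \<Rightarrow> nat set \<Rightarrow> ('m \<times> nat) set" where
  "cech_zero scale x n p =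
     (\<lambda>I\<in>cech_index n p. \<zero>\<^bsub>localization scale (\<Prod>i\<in>I. x i)\<^esub>)"

definition cech_diff ::
  "('r::comm_ring_1 \<Rightarrow> 'm::ab_group_add \<Rightarrow> 'm) \<Rightarrow> (nat \<Rightarrow> 'r) \<Rightarrow> nat \<Rightarrow> nat
     \<Rightarrow> (nat set \<Rightarrow> ('m \<times> nat) set) \<Rightarrow> nat set \<Rightarrow> ('m \<times> nat) set" where
  "cech_diff scale x n p c =
     (\<lambda>J\<in>cech_index n (p + 1).
        \<Oplus>\<^bsub>localization scale (\<Prod>i\<in>J. x i)\<^esub>j\<in>J.
          (- 1) ^ card {i \<in> J. i < j} \<odot>\<^bsub>localization scale (\<Prod>i\<in>J. x i)\<^esub>
            loc_map scale (\<Prod>i\<in>J - {j}. x i) (x j) (c (J - {j})))"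

definition cech_cocycles ::
  "('r::comm_ring_1 \<Rightarrow> 'm::ab_group_add \<Rightarrow> 'm) \<Rightarrow> (int \<Rightarrow> 'm set) \<Rightarrow> (nat \<Rightarrow> 'r) \<Rightarrow> nat
     \<Rightarrow> nat \<Rightarrow> int \<Rightarrow> (nat set \<Rightarrow> ('m \<times> nat) set) set" where
  "cech_cocycles scale M x n p t =
     {c \<in> cech_cochains scale M x n p t. cech_diff scale x n p c = cech_zero scale x n (p + 1)}"

definition cech_coboundaries ::
  "('r::comm_ring_1 \<Rightarrow> 'm::ab_group_add \<Rightarrow> 'm) \<Rightarrow> (int \<Rightarrow> 'm set) \<Rightarrow> (nat \<Rightarrow> 'r) \<Rightarrow> nat
     \<Rightarrow> nat \<Rightarrow> int \<Rightarrow> (nat set \<Rightarrow> ('m \<times> nat) set) set" where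
  "cech_coboundaries scale M x n p t =
     (case p of 0 \<Rightarrow> {cech_zero scale x n 0}
      | Suc q \<Rightarrow> cech_diff scale x n q ` cech_cochains scale M x n q t)"

definition a_local_cohomology ::
  "('r::comm_ring_1 \<Rightarrow> 'm::ab_group_add \<Rightarrow> 'm) \<Rightarrow> (int \<Rightarrow> 'm set) \<Rightarrow> (nat \<Rightarrow> 'r) \<Rightarrow> nat
     \<Rightarrow> nat \<Rightarrow> ereal" where
  "a_local_cohomology scale M x n i =
     a_inv (cech_cocycles scale M x n i) (cech_coboundaries scale M x n i)"

definition reg ::
  "('r::comm_ring_1 \<Rightarrow> 'm::ab_group_add \<Rightarrow> 'm) \<Rightarrow> (int \<Rightarrow> 'm set) \<Rightarrow> (nat \<Rightarrow> 'r) \<Rightarrow> nat \<Rightarrow> ereal"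
where
  "reg scale M x n = (SUP i. a_local_cohomology scale M x n i + ereal (real i))"

end

theory Submission
  imports Defs
begin

text \<open>
  For a filter-regular linear form \<open>z\<close> on \<open>M/N\<close>, the long exact sequence of local cohomology gives
  \<open>reg (M/N) = max (a((N : z)/N)) (reg (M/(N + zM)))\<close>: multiplication by \<open>z\<close> from
  \<open>H\<^sup>p(M/N)\<^sub>t\<close> to the component of degree \<open>t + 1\<close> is injective once the cohomology of
  \<open>M/(N + zM)\<close> vanishes in total degree \<open>t + p\<close>, whereas every class is killed by a power of \<open>z\<close>.
  Iterating over \<open>z 1, \<dots>, z s\<close> leads to \<open>M/QM\<close>, which vanishes in large degrees, so that its
  regularity is its top degree. The formula with \<open>Q\<^sub>iM : R\<^sub>+\<close> follows because a graded module
  vanishing in large degrees has its top degree annihilated by \<open>R\<^sub>+\<close>.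

  Instead of quotients, the argument uses representatives in \<open>M\<close> and works modulo the homogeneous
  submodule \<open>N\<close>; a Cech cochain is represented by a Koszul cochain of numerators over a common
  denominator.
\<close>

section \<open>Homogeneous components\<close>

text \<open>The Cech complex is the direct limit of the Koszul complexes on the powers
  \<open>x i ^ k\<close>. The existential quantifiers over levels come from this limit: an identity
  of fractions becomes one of numerators only after multiplication by a further power of the
  denominators. The obstacle is that filter-regularity says nothing in small degrees, so
  \<open>z\<close> cannot simply be cancelled modulo \<open>N\<close>. Raising the level leaves the
  Cech cochain unchanged, but for \<open>p > 0\<close> it pushes the numerators into arbitrarily
  high degrees, where cancellation is allowed; this is the cochain form of the fact that (N : z)/N
  has no higher local cohomology. Only for \<open>p = 0\<close> do the degrees stay fixed, and this
  is where a((N : z)/N) enters. The equalities of the theorem are obtained by comparing real upper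
  bounds \<open>r\<close>: that a maximum is at most \<open>r\<close> is a conjunction, and infinite
  values need no separate treatment.\<close>

lemma is_grading_closed:
  assumes "is_grading S"
  shows is_grading_zero: "0 \<in> S i"
    and is_grading_diff: "a \<in> S i \<Longrightarrow> b \<in> S i \<Longrightarrow> a - b \<in> S i"
    and is_grading_uminus: "a \<in> S i \<Longrightarrow> - a \<in> S i"
    and is_grading_add: "a \<in> S i \<Longrightarrow> b \<in> S i \<Longrightarrow> a + b \<in> S i"
proof -
  have closed: "0 \<in> S i \<and> (\<forall>a\<in>S i. \<forall>b\<in>S i. a - b \<in> S i)"
    using assms unfolding is_grading_def by (rule conjunct1[THEN spec])
  then show zero: "0 \<in> S i"
    by (rule conjunct1)
  show diff: "a - b \<in> S i" if "a \<in> S i" "b \<in> S i" for a b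
    using conjunct2[OF closed] that by simp
  show uminus: "- a \<in> S i" if "a \<in> S i" for a
    using diff[OF zero that] by simp
  show "a + b \<in> S i" if "a \<in> S i" "b \<in> S i" for a b
    using diff[OF that(1) uminus[OF that(2)]] by simp
qed

lemma is_grading_sum:
  assumes "is_grading S" "\<And>j. j \<in> A \<Longrightarrow> f j \<in> S i"
  shows "sum f A \<in> S i"
  using assms(2)
  by (induction A rule: infinite_finite_induct)
    (auto intro: is_grading_zero[OF assms(1)] is_grading_add[OF assms(1)])

text \<open>A grading is given by its components alone, so the projection is read off from an
  arbitrary finite decomposition. The value 0 outside the index set makes the result independent of
  the decomposition.\<close>

definition hom_component :: "('i \<Rightarrow> 'a::ab_group_add set) \<Rightarrow> 'i \<Rightarrow> 'a \<Rightarrow> 'a" where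
  "hom_component S t u = (THE y. \<exists>A f. finite A \<and> (\<forall>i\<in>A. f i \<in> S i) \<and> u = (\<Sum>i\<in>A. f i) \<and>
     y = (if t \<in> A then f t else 0))"

lemma sum_extend_by_zero:
  assumes "finite B" "A \<subseteq> B"
  shows "(\<Sum>i\<in>B. if i \<in> A then f i else 0) = sum f A"
  unfolding sum.inter_restrict[OF assms(1), symmetric] Int_absorb1[OF assms(2)] ..

text \<open>Extended by 0 to \<open>A \<union> B\<close>, the two families differ by a decomposition
  of 0, whose terms vanish by the independence clause of the grading.\<close>

lemma is_grading_unique:
  assumes "is_grading S" "finite A" "finite B" "\<And>i. i \<in> A \<Longrightarrow> f i \<in> S i" "\<And>i. i \<in> B \<Longrightarrow> g i \<in> S i"
    and eq: "sum f A = sum g B"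
  shows "(if t \<in> A then f t else 0) = (if t \<in> B then g t else 0)"
proof (cases "t \<in> A \<union> B")
  case True
  define F where "F i = (if i \<in> A then f i else 0)" for i
  define G where "G i = (if i \<in> B then g i else 0)" for i
  have "sum F (A \<union> B) = sum f A" "sum G (A \<union> B) = sum g B"
    unfolding F_def G_def using assms(2,3) by (auto intro!: sum_extend_by_zero)
  then have "(\<Sum>i\<in>A \<union> B. F i - G i) = 0"
    by (simp add: sum_subtractf eq)
  moreover have "\<forall>i\<in>A \<union> B. F i - G i \<in> S i"
    using assms(4,5) by (auto simp: F_def G_def intro!: is_grading_closed[OF assms(1)])
  moreover have "finite (A \<union> B)"
    using assms(2,3) by simp
  moreover have "\<forall>A f. finite A \<longrightarrow> (\<forall>i\<in>A. f i \<in> S i) \<longrightarrow> (\<Sum>i\<in>A. f i) = 0 \<longrightarrow> (\<forall>i\<in>A. f i = 0)"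
    using assms(1) unfolding is_grading_def by (elim conjE)
  ultimately have "\<forall>i\<in>A \<union> B. F i - G i = 0"
    by (elim allE[of _ "A \<union> B"] allE[of _ "\<lambda>i. F i - G i"]) simp
  with True show ?thesis
    by (simp add: F_def G_def)
qed auto

lemma hom_component_sum:
  assumes "is_grading S" "finite A" "\<And>i. i \<in> A \<Longrightarrow> f i \<in> S i"
  shows "hom_component S t (sum f A) = (if t \<in> A then f t else 0)"
  unfolding hom_component_def
proof (rule the_equality)
  show "\<exists>B g. finite B \<and> (\<forall>i\<in>B. g i \<in> S i) \<and> sum f A = sum g B \<and>
     (if t \<in> A then f t else 0) = (if t \<in> B then g t else 0)"
    using assms by blast
next
  fix y
  assume "\<exists>B g. finite B \<and> (\<forall>i\<in>B. g i \<in> S i) \<and> sum f A = sum g B \<and> y = (if t \<in> B then g t else 0)"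
  then show "y = (if t \<in> A then f t else 0)"
    using is_grading_unique[OF assms(1,2) _ assms(3)] by metis
qed

lemma is_grading_decompose:
  assumes "is_grading S"
  obtains A f where "finite A" "\<And>i. i \<in> A \<Longrightarrow> f i \<in> S i" "u = sum f A"
proof -
  have "u \<in> sum_of_family S UNIV"
    using assms unfolding is_grading_def by simp
  then show ?thesis
    using that unfolding sum_of_family_def by blast
qed

lemma hom_component_mem:
  assumes "is_grading S"
  shows "hom_component S t u \<in> S t"
proof -
  obtain A f where "finite A" "\<And>i. i \<in> A \<Longrightarrow> f i \<in> S i" "u = sum f A"
    using is_grading_decompose[OF assms] by metis
  then show ?thesis
    using hom_component_sum[OF assms, of A f t] is_grading_zero[OF assms] by auto
qed

lemma hom_component_id:
  assumes "is_grading S" "u \<in> S t"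
  shows "hom_component S t u = u"
  using hom_component_sum[OF assms(1), of "{t}" "\<lambda>_. u" t] assms(2) by simp

lemma hom_component_add:
  assumes S: "is_grading S"
  shows "hom_component S t (u + v) = hom_component S t u + hom_component S t v"
proof -
  obtain A f where u: "finite A" "\<And>i. i \<in> A \<Longrightarrow> f i \<in> S i" "u = sum f A"
    using is_grading_decompose[OF S] by metis
  obtain B g where v: "finite B" "\<And>i. i \<in> B \<Longrightarrow> g i \<in> S i" "v = sum g B"
    using is_grading_decompose[OF S] by metis
  define F where "F i = (if i \<in> A then f i else 0)" for i
  define G where "G i = (if i \<in> B then g i else 0)" for i
  have mem: "F i \<in> S i" "G i \<in> S i" for i
    using u(2) v(2) is_grading_zero[OF S] by (auto simp: F_def G_def)
  have F: "u = sum F (A \<union> B)" and G: "v = sum G (A \<union> B)"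
    unfolding F_def G_def u(3) v(3) using u(1) v(1)
    by (auto intro!: sum_extend_by_zero[symmetric])
  have "hom_component S t (sum h (A \<union> B)) = (if t \<in> A \<union> B then h t else 0)"
    if "\<And>i. h i \<in> S i" for h
    using hom_component_sum[OF S, of "A \<union> B" h t] u(1) v(1) that by simp
  note this[of F] this[of G] this[of "\<lambda>i. F i + G i"]
  then show ?thesis
    unfolding F G sum.distrib[symmetric] using mem is_grading_add[OF S mem] by simp
qed

lemma hom_component_zero:
  assumes S: "is_grading S"
  shows "hom_component S t 0 = 0"
  using hom_component_id[OF S is_grading_zero[OF S]] .

lemma hom_component_uminus:
  assumes S: "is_grading S"
  shows "hom_component S t (- u) = - hom_component S t u"
proof -
  have "hom_component S t u + hom_component S t (- u) = 0"
    unfolding hom_component_add[OF S, symmetric] right_minus by (rule hom_component_zero[OF S])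
  then show ?thesis
    by (rule minus_unique[symmetric])
qed

lemma hom_component_diff:
  assumes S: "is_grading S"
  shows "hom_component S t (u - v) = hom_component S t u - hom_component S t v"
  unfolding diff_conv_add_uminus hom_component_add[OF S] hom_component_uminus[OF S] ..

lemma hom_component_sum_right:
  assumes S: "is_grading S"
  shows "hom_component S t (sum f A) = (\<Sum>i\<in>A. hom_component S t (f i))"
  by (induction A rule: infinite_finite_induct)
    (auto simp: hom_component_zero[OF S] hom_component_add[OF S])

context graded_module
begin

lemmas module_grading_intros =
  is_grading_zero[OF module_grading] is_grading_diff[OF module_grading]
  is_grading_add[OF module_grading] is_grading_uminus[OF module_grading]

lemma power_mem: "a \<in> R m \<Longrightarrow> a ^ k \<in> R (m * k)"
  using one_mem mult_mem by (induction k) (auto simp: algebra_simps)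

lemma prod_mem:
  assumes "finite I" "\<And>i. i \<in> I \<Longrightarrow> f i \<in> R m"
  shows "prod f I \<in> R (m * card I)"
  using assms one_mem mult_mem by (induction I) (auto simp: algebra_simps)

lemma hom_component_scale:
  assumes "a \<in> R m"
  shows "hom_component M (int m + t) (scale a u) = scale a (hom_component M t u)"
proof -
  obtain A f where u: "finite A" "\<And>i. i \<in> A \<Longrightarrow> f i \<in> M i" "u = sum f A"
    using is_grading_decompose[OF module_grading] by metis
  have "scale a u = (\<Sum>i\<in>A. scale a (f i))"
    by (simp add: u scale_sum_right)
  also have "\<dots> = (\<Sum>i\<in>(+) (int m) ` A. scale a (f (i - int m)))"
    by (subst sum.reindex) auto
  finally have eq: "scale a u = \<dots>" .
  have "hom_component M (int m + t) (scale a u) =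
    (if int m + t \<in> (+) (int m) ` A then scale a (f (int m + t - int m)) else 0)"
    unfolding eq
    by (rule hom_component_sum[OF module_grading]) (use u assms in \<open>auto intro!: scale_mem\<close>)
  also have "\<dots> = scale a (if t \<in> A then f t else 0)"
    by auto
  also have "\<dots> = scale a (hom_component M t u)"
    using hom_component_sum[OF module_grading u(1), of f t] u(2,3) by simp
  finally show ?thesis .
qed

section \<open>Homogeneous submodules and the submodules generated by initial segments of the
  sequence\<close>

definition homogeneous :: "'m set \<Rightarrow> bool" where
  "homogeneous N \<longleftrightarrow> subspace N \<and> (\<forall>u\<in>N. \<forall>t. hom_component M t u \<in> N)"

lemma homogeneous_zero: "homogeneous {0}"
  by (auto simp: homogeneous_def hom_component_zero[OF module_grading])

text \<open>This is N + zM, the submodule to pass to when M/N is divided by \<open>z\<close>. The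
  explicit sum hands out both summands of an element.\<close>

definition add_multiples :: "'r \<Rightarrow> 'm set \<Rightarrow> 'm set" where
  "add_multiples z N = {u + scale z v | u v. u \<in> N}"

lemma subspace_add_multiples:
  assumes "subspace N"
  shows "subspace (add_multiples z N)"
proof (rule subspaceI)
  show "0 \<in> add_multiples z N"
    unfolding add_multiples_def using subspace_0[OF assms] scale_zero_right[of z]
    by (metis (mono_tags, lifting) add_0 mem_Collect_eq)
next
  fix u v assume "u \<in> add_multiples z N" "v \<in> add_multiples z N"
  then obtain a b c d where "u = a + scale z b" "v = c + scale z d" "a \<in> N" "c \<in> N"
    unfolding add_multiples_def by blast
  then have "u + v = (a + c) + scale z (b + d)" "a + c \<in> N"
    using subspace_add[OF assms] by (auto simp: scale_right_distrib)
  then show "u + v \<in> add_multiples z N"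
    unfolding add_multiples_def by blast
next
  fix r u assume "u \<in> add_multiples z N"
  then obtain a b where "u = a + scale z b" "a \<in> N"
    unfolding add_multiples_def by blast
  then have "scale r u = scale r a + scale z (scale r b)" "scale r a \<in> N"
    using subspace_scale[OF assms] by (auto simp: scale_right_distrib mult.commute)
  then show "scale r u \<in> add_multiples z N"
    unfolding add_multiples_def by blast
qed

lemma homogeneous_add_multiples:
  assumes "homogeneous N" "z \<in> R 1"
  shows "homogeneous (add_multiples z N)"
  unfolding homogeneous_def
proof (intro conjI ballI allI)
  show "subspace (add_multiples z N)"
    using assms subspace_add_multiples unfolding homogeneous_def by blast
  fix u t assume "u \<in> add_multiples z N"
  then obtain a b where u: "u = a + scale z b" "a \<in> N"
    unfolding add_multiples_def by blast
  have "hom_component M t u = hom_component M t a + scale z (hom_component M (t - 1) b)"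
    using hom_component_scale[OF assms(2), of "t - 1" b]
    by (simp add: u hom_component_add[OF module_grading])
  moreover have "hom_component M t a \<in> N"
    using assms(1) u(2) unfolding homogeneous_def by blast
  ultimately show "hom_component M t u \<in> add_multiples z N"
    unfolding add_multiples_def by blast
qed

text \<open>Taking components of degree \<open>t\<close> keeps the first summand in \<open>N\<close>
  and makes the cofactor of \<open>z\<close> homogeneous of degree \<open>t - 1\<close>. Dividing by
  \<open>z\<close> with control of the degree is the basic move in the diagram chases on
  cochains.\<close>

lemma add_multiples_homogeneous_cases:
  assumes "homogeneous N" "z \<in> R 1" "u \<in> add_multiples z N" "u \<in> M t"
  obtains e where "u - scale z e \<in> N" "e \<in> M (t - 1)"
proof -
  obtain a b where u: "u = a + scale z b" "a \<in> N"
    using assms(3) unfolding add_multiples_def by blast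
  have "u = hom_component M t u"
    using hom_component_id[OF module_grading assms(4)] by simp
  also have "\<dots> = hom_component M t a + scale z (hom_component M (t - 1) b)"
    using hom_component_scale[OF assms(2), of "t - 1" b]
    by (simp add: u hom_component_add[OF module_grading])
  finally have "u - scale z (hom_component M (t - 1) b) = hom_component M t a"
    by (simp add: algebra_simps)
  moreover have "hom_component M t a \<in> N"
    using assms(1) u(2) unfolding homogeneous_def by blast
  ultimately show ?thesis
    using that hom_component_mem[OF module_grading] by metis
qed

lemma ideal_mult_ideal_gen:
  "ideal_mult scale (ideal_gen Z) = span {scale q m | q m. q \<in> Z}"
proof
  interpret ring: Modules.module "(*) :: 'r \<Rightarrow> 'r \<Rightarrow> 'r"
    by unfold_locales (auto simp: algebra_simps)
  show "span {scale q m | q m. q \<in> Z} \<subseteq> ideal_mult scale (ideal_gen Z)"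
    unfolding ideal_mult_def ideal_gen_def
    by (rule span_mono) (auto intro: ring.span_base)
  have "scale q m \<in> span {scale q m | q m. q \<in> Z}" if "q \<in> ring.span Z" for q m
    using that
  proof (induction rule: ring.span_induct_alt)
    case (step c a y)
    have "scale (c * a) m \<in> span {scale q m | q m. q \<in> Z}"
      unfolding scale_scale[symmetric]
      by (rule span_scale, rule span_base) (use step in auto)
    then show ?case
      using step by (auto simp: scale_left_distrib intro: span_add)
  qed (auto simp: span_zero)
  then show "ideal_mult scale (ideal_gen Z) \<subseteq> span {scale q m | q m. q \<in> Z}"
    unfolding ideal_mult_def ideal_gen_def
    by (intro span_minimal) auto
qed

lemma QM_0: "QM scale z 0 = {0}"
  unfolding QM_def ideal_mult_ideal_gen by simp

lemma QM_Suc: "QM scale z (Suc i) = add_multiples (z (Suc i)) (QM scale z i)"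
proof
  define G where "G i = {scale q m | q m. q \<in> z ` {1..i}}" for i
  have QM: "QM scale z i = span (G i)" for i
    unfolding QM_def ideal_mult_ideal_gen G_def ..
  have G: "G (Suc i) = G i \<union> range (scale (z (Suc i)))"
    unfolding G_def by (auto simp: atLeastAtMostSuc_conv)
  have "G (Suc i) \<subseteq> add_multiples (z (Suc i)) (span (G i))"
  proof
    fix u assume "u \<in> G (Suc i)"
    then consider "u \<in> G i" | v where "u = scale (z (Suc i)) v"
      unfolding G by blast
    then show "u \<in> add_multiples (z (Suc i)) (span (G i))"
    proof cases
      case 1
      then have "u = u + scale (z (Suc i)) 0" "u \<in> span (G i)"
        by (auto intro: span_base)
      then show ?thesis unfolding add_multiples_def by blast
    next
      case 2
      then have "u = 0 + scale (z (Suc i)) v"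
        by simp
      then show ?thesis unfolding add_multiples_def using span_zero by blast
    qed
  qed
  then show "QM scale z (Suc i) \<subseteq> add_multiples (z (Suc i)) (QM scale z i)"
    unfolding QM by (intro span_minimal subspace_add_multiples) auto
  show "add_multiples (z (Suc i)) (QM scale z i) \<subseteq> QM scale z (Suc i)"
  proof
    fix u assume "u \<in> add_multiples (z (Suc i)) (QM scale z i)"
    then obtain a b where u: "u = a + scale (z (Suc i)) b" "a \<in> span (G i)"
      unfolding add_multiples_def QM by blast
    have "a \<in> span (G (Suc i))"
      using u(2) span_mono[of "G i" "G (Suc i)"] G by blast
    moreover have "scale (z (Suc i)) b \<in> span (G (Suc i))"
      by (rule span_base) (simp add: G)
    ultimately show "u \<in> QM scale z (Suc i)"
      unfolding QM u(1) by (rule span_add)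
  qed
qed

lemma homogeneous_QM:
  assumes "\<forall>j\<in>{1..i}. z j \<in> R 1"
  shows "homogeneous (QM scale z i)"
  using assms
  by (induction i) (auto simp: QM_0 QM_Suc homogeneous_zero intro!: homogeneous_add_multiples)

end

section \<open>Vanishing of Cech cohomology in terms of Koszul cochains\<close>

text \<open>In each term of the binomial expansion, the exponent of \<open>u\<close> is at least
  \<open>a\<close> or that of \<open>v\<close> is at least \<open>b\<close>.\<close>

lemma power_add_mem_ideal:
  fixes u v :: "'a::comm_ring_1"
  assumes A: "module.subspace (*) A" and "u ^ a \<in> A" "v ^ b \<in> A"
  shows "(u + v) ^ (a + b) \<in> A"
proof -
  interpret Modules.module "(*) :: 'a \<Rightarrow> 'a \<Rightarrow> 'a"
    by unfold_locales (auto simp: algebra_simps)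
  have "of_nat (a + b choose i) * u ^ i * v ^ (a + b - i) \<in> A" if "i \<le> a + b" for i
  proof (cases "a \<le> i")
    case True
    then have "u ^ i = u ^ (i - a) * u ^ a"
      by (simp flip: power_add)
    then have "of_nat (a + b choose i) * u ^ i * v ^ (a + b - i) =
      (of_nat (a + b choose i) * u ^ (i - a) * v ^ (a + b - i)) * u ^ a"
      by (simp only: mult_ac)
    then show ?thesis
      using subspace_scale[OF A assms(2)] by simp
  next
    case False
    then have "v ^ (a + b - i) = v ^ (a - i) * v ^ b"
      by (simp flip: power_add)
    then have "of_nat (a + b choose i) * u ^ i * v ^ (a + b - i) =
      (of_nat (a + b choose i) * u ^ i * v ^ (a - i)) * v ^ b"
      by (simp only: mult_ac)
    then show ?thesis
      using subspace_scale[OF A assms(3)] by simp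
  qed
  then show ?thesis
    unfolding binomial_ring by (intro subspace_sum[OF A]) auto
qed

text \<open>Intended for the ideal \<open>A\<close> of scalars killing a cohomology class: the
  powers \<open>x j ^ k\<close> lie in it, and the conclusion carries this over to an arbitrary
  linear form.\<close>

lemma power_mem_ideal_of_generators:
  fixes z :: "'a::comm_ring_1"
  assumes A: "module.subspace (*) A" and z: "z \<in> ideal_gen G" and G: "\<And>g. g \<in> G \<Longrightarrow> g ^ k \<in> A"
  shows "\<exists>K. z ^ K \<in> A"
proof -
  interpret Modules.module "(*) :: 'a \<Rightarrow> 'a \<Rightarrow> 'a"
    by unfold_locales (auto simp: algebra_simps)
  from z show ?thesis
    unfolding ideal_gen_def
  proof (induction rule: span_induct_alt)
    case base
    have "0 ^ 1 \<in> A"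
      using subspace_0[OF A] by simp
    then show ?case ..
  next
    case (step c y w)
    then obtain K where "w ^ K \<in> A" by blast
    moreover have "(c * y) ^ k \<in> A"
      using subspace_scale[OF A G[OF step(1)]] by (simp add: power_mult_distrib)
    ultimately show ?case
      using power_add_mem_ideal[OF A] by blast
  qed
qed

definition koszul_sign :: "nat set \<Rightarrow> nat \<Rightarrow> 'a::comm_ring_1" where
  "koszul_sign J j = (- 1) ^ card {i \<in> J. i < j}"

lemma koszul_sign_square: "koszul_sign J j * koszul_sign J j = 1"
  by (simp add: koszul_sign_def flip: power_add)

lemma koszul_sign_remove:
  assumes "finite J" "i \<in> J"
  shows "koszul_sign J j = (if i < j then - 1 else 1) * koszul_sign (J - {i}) j"
proof (cases "i < j")
  case True
  then have "{k \<in> J. k < j} = insert i {k \<in> J - {i}. k < j}"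
    using assms by auto
  then have "card {k \<in> J. k < j} = Suc (card {k \<in> J - {i}. k < j})"
    using assms(1) by simp
  with True show ?thesis
    by (simp add: koszul_sign_def)
next
  case False
  then have "{k \<in> J. k < j} = {k \<in> J - {i}. k < j}"
    by auto
  with False show ?thesis
    by (simp add: koszul_sign_def)
qed

text \<open>Removing one of the two indices shifts the position of the other only if it is the
  smaller one, so exactly one of the signs flips.\<close>

lemma koszul_sign_swap:
  assumes "finite J" "i \<in> J" "j \<in> J" "i \<noteq> j"
  shows "koszul_sign J j * koszul_sign (J - {j}) i = - (koszul_sign J i * koszul_sign (J - {i}) j)"
  using assms by (simp add: koszul_sign_remove[OF assms(1,2), of j] koszul_sign_remove[OF assms(1,3), of i])

section \<open>Koszul cochains and their differential\<close>

locale graded_module_linear_forms = graded_module R scale M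
  for R :: "nat \<Rightarrow> 'r::comm_ring_1 set"
    and scale :: "'r \<Rightarrow> 'm::ab_group_add \<Rightarrow> 'm"
    and M :: "int \<Rightarrow> 'm set" +
  fixes x :: "nat \<Rightarrow> 'r" and n :: nat
  assumes x_linear: "\<And>i. i < n \<Longrightarrow> x i \<in> R 1"
    and x_generate: "R 1 \<subseteq> ideal_gen (x ` {..<n})"
begin

text \<open>An integer \<open>p\<close> lets \<open>p - 1\<close> be used without a case
  distinction: there are no index sets in degree -1, and the differential at the empty set is an
  empty sum, so nonzero coboundaries in degree 0 do not arise.\<close>

definition index_sets :: "int \<Rightarrow> nat set set" where
  "index_sets p = {I. I \<subseteq> {..<n} \<and> int (card I) = p}"

lemma finite_index: "I \<in> index_sets p \<Longrightarrow> finite I"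
  unfolding index_sets_def using finite_subset by blast

lemma index_sets_remove: "J \<in> index_sets p \<Longrightarrow> j \<in> J \<Longrightarrow> J - {j} \<in> index_sets (p - 1)"
  using finite_index[of J p] card_gt_0_iff[of J] unfolding index_sets_def
  by (auto simp: card_Diff_singleton)

lemma index_sets_insert: "J \<in> index_sets p \<Longrightarrow> j \<notin> J \<Longrightarrow> j < n \<Longrightarrow> insert j J \<in> index_sets (p + 1)"
  using finite_index[of J p] unfolding index_sets_def by auto

lemma index_sets_negative: "p < 0 \<Longrightarrow> index_sets p = {}"
  unfolding index_sets_def by auto

text \<open>
  A cochain \<open>c\<close> of level \<open>k\<close> represents the Cech cochain with components \<open>c I / (\<Prod>i\<in>I. x i) ^ k\<close>;
  passing to level \<open>k + l\<close> multiplies \<open>c I\<close> by \<open>(\<Prod>i\<in>I. x i) ^ l\<close>.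
\<close>

definition koszul_cochains :: "int \<Rightarrow> nat \<Rightarrow> int \<Rightarrow> (nat set \<Rightarrow> 'm) set" where
  "koszul_cochains p k t = {c. \<forall>I\<in>index_sets p. c I \<in> M (t + int k * p)}"

definition raise_level :: "nat \<Rightarrow> (nat set \<Rightarrow> 'm) \<Rightarrow> nat set \<Rightarrow> 'm" where
  "raise_level l c I = scale ((\<Prod>i\<in>I. x i) ^ l) (c I)"

text \<open>The factor \<open>x j ^ k\<close> expands a fraction from the denominator
  \<open>(\<Prod>i\<in>J - {j}. x i) ^ k\<close> to
  \<open>(\<Prod>i\<in>J. x i) ^ k\<close>.\<close>

definition koszul_diff :: "nat \<Rightarrow> (nat set \<Rightarrow> 'm) \<Rightarrow> nat set \<Rightarrow> 'm" where
  "koszul_diff k c J = (\<Sum>j\<in>J. scale (koszul_sign J j * x j ^ k) (c (J - {j})))"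

definition koszul_cocycle :: "'m set \<Rightarrow> int \<Rightarrow> nat \<Rightarrow> (nat set \<Rightarrow> 'm) \<Rightarrow> bool" where
  "koszul_cocycle N p k c \<longleftrightarrow> (\<forall>J\<in>index_sets (p + 1). koszul_diff k c J \<in> N)"

text \<open>The additional level \<open>l\<close> expresses that a class is zero in the direct
  limit, not necessarily in the Koszul complex of level \<open>k\<close>.\<close>

definition koszul_coboundary :: "'m set \<Rightarrow> int \<Rightarrow> nat \<Rightarrow> int \<Rightarrow> (nat set \<Rightarrow> 'm) \<Rightarrow> bool" where
  "koszul_coboundary N p k t c \<longleftrightarrow> (\<exists>l. \<exists>b\<in>koszul_cochains (p - 1) (k + l) t.
     \<forall>I\<in>index_sets p. raise_level l c I - koszul_diff (k + l) b I \<in> N)"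

text \<open>The vanishing of the component of degree \<open>t\<close> of the \<open>p\<close>-th local cohomology of \<open>M/N\<close>.\<close>

definition cohomology_vanishes :: "'m set \<Rightarrow> int \<Rightarrow> int \<Rightarrow> bool" where
  "cohomology_vanishes N p t \<longleftrightarrow>
     (\<forall>k. \<forall>c\<in>koszul_cochains p k t. koszul_cocycle N p k c \<longrightarrow> koszul_coboundary N p k t c)"

lemma scale_int_mem: "a \<in> R m \<Longrightarrow> u \<in> M t \<Longrightarrow> t' = int m + t \<Longrightarrow> scale a u \<in> M t'"
  using scale_mem by simp

lemma x_power_mem: "i < n \<Longrightarrow> x i ^ k \<in> R k"
  using power_mem[OF x_linear, of i k] by simp

lemma x_prod_power_mem:
  assumes "I \<in> index_sets p"
  shows "(\<Prod>i\<in>I. x i) ^ l \<in> R (nat p * l)"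
proof -
  have "(\<Prod>i\<in>I. x i) \<in> R (1 * card I)"
    using assms unfolding index_sets_def
    by (intro prod_mem x_linear finite_index[OF assms]) auto
  then show ?thesis
    using power_mem[of _ "card I" l] assms unfolding index_sets_def by auto
qed

lemma index_sets_nonneg: "I \<in> index_sets p \<Longrightarrow> 0 \<le> p"
  unfolding index_sets_def by auto

lemma koszul_sign_scale: "scale (koszul_sign J j) u \<in> M t \<longleftrightarrow> u \<in> M t"
proof -
  have "(koszul_sign J j :: 'r) = 1 \<or> (koszul_sign J j :: 'r) = - 1"
    unfolding koszul_sign_def by (metis neg_one_even_power neg_one_odd_power)
  then show ?thesis
    using is_grading_uminus[OF module_grading, of u] is_grading_uminus[OF module_grading, of "- u"] by auto
qed

lemma raise_level_mem:
  assumes "c \<in> koszul_cochains p k t"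
  shows "raise_level l c \<in> koszul_cochains p (k + l) t"
  unfolding koszul_cochains_def raise_level_def
proof (intro CollectI ballI)
  fix I assume I: "I \<in> index_sets p"
  show "scale ((\<Prod>i\<in>I. x i) ^ l) (c I) \<in> M (t + int (k + l) * p)"
    by (rule scale_int_mem[OF x_prod_power_mem[OF I]])
      (use I assms index_sets_nonneg[OF I] in \<open>auto simp: koszul_cochains_def algebra_simps\<close>)
qed

lemma koszul_diff_mem:
  assumes "c \<in> koszul_cochains p k t"
  shows "koszul_diff k c \<in> koszul_cochains (p + 1) k t"
  unfolding koszul_cochains_def koszul_diff_def
proof (intro CollectI ballI is_grading_sum[OF module_grading])
  fix J j assume J: "J \<in> index_sets (p + 1)" "j \<in> J"
  have "c (J - {j}) \<in> M (t + int k * p)"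
    using index_sets_remove[OF J] assms by (auto simp: koszul_cochains_def)
  moreover have "j < n"
    using J unfolding index_sets_def by auto
  ultimately have "scale (x j ^ k) (c (J - {j})) \<in> M (t + int k * (p + 1))"
    by (intro scale_int_mem[OF x_power_mem]) (auto simp: algebra_simps)
  then show "scale (koszul_sign J j * x j ^ k) (c (J - {j})) \<in> M (t + int k * (p + 1))"
    unfolding scale_scale[symmetric] koszul_sign_scale .
qed

lemma raise_level_0: "raise_level 0 c = c"
  by (simp add: raise_level_def fun_eq_iff)

lemma raise_level_raise_level: "raise_level l (raise_level m c) = raise_level (m + l) c"
  by (simp add: raise_level_def fun_eq_iff power_add mult.commute)

text \<open>Raising the level is a chain map: of the factor \<open>prod x J ^ l\<close>, the part
  \<open>x j ^ l\<close> is absorbed by the differential, and the rest raises the component at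
  \<open>J - {j}\<close>.\<close>

lemma raise_level_koszul_diff:
  assumes "finite J"
  shows "raise_level l (koszul_diff k c) J = koszul_diff (k + l) (raise_level l c) J"
  unfolding raise_level_def koszul_diff_def scale_sum_right
proof (rule sum.cong[OF refl])
  fix j assume "j \<in> J"
  then have "prod x J = x j * prod x (J - {j})"
    using assms by (simp add: prod.remove)
  then show "scale (prod x J ^ l) (scale (koszul_sign J j * x j ^ k) (c (J - {j}))) =
    scale (koszul_sign J j * x j ^ (k + l)) (scale (prod x (J - {j}) ^ l) (c (J - {j})))"
    by (simp add: power_mult_distrib power_add mult_ac)
qed

lemma koszul_diff_add: "koszul_diff k (\<lambda>I. b I + c I) J = koszul_diff k b J + koszul_diff k c J"
  by (simp add: koszul_diff_def scale_right_distrib sum.distrib)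

lemma koszul_diff_diff: "koszul_diff k (\<lambda>I. b I - c I) J = koszul_diff k b J - koszul_diff k c J"
  by (simp add: koszul_diff_def scale_right_diff_distrib sum_subtractf)

lemma koszul_diff_scale: "koszul_diff k (\<lambda>I. scale a (c I)) J = scale a (koszul_diff k c J)"
  by (simp add: koszul_diff_def scale_sum_right mult.commute)

lemma koszul_diff_zero: "koszul_diff k (\<lambda>I. 0) J = 0"
  by (simp add: koszul_diff_def)

lemma koszul_diff_subspace:
  assumes "subspace N" "\<And>j. j \<in> J \<Longrightarrow> c (J - {j}) \<in> N"
  shows "koszul_diff k c J \<in> N"
  unfolding koszul_diff_def using assms by (intro subspace_sum subspace_scale)

text \<open>Removing two indices in either order leads to the same component with opposite signs, so
  the terms with \<open>i < j\<close> cancel those with \<open>j < i\<close>.\<close>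

lemma koszul_diff_koszul_diff:
  assumes "finite J"
  shows "koszul_diff k (koszul_diff k c) J = 0"
proof -
  define f where "f j i = scale ((koszul_sign J j * koszul_sign (J - {j}) i) * (x j ^ k * x i ^ k))
    (c (J - {j} - {i}))" for j i
  have swap: "f j i = - f i j" if "i \<in> J" "j \<in> J" "i \<noteq> j" for i j
  proof -
    have "J - {j} - {i} = J - {i} - {j}" by auto
    then show ?thesis
      unfolding f_def koszul_sign_swap[OF assms that]
      by (simp add: mult.commute[of "x i ^ k"])
  qed
  define P where "P = {(j, i). j \<in> J \<and> i \<in> J \<and> i < j}"
  define P' where "P' = {(j, i). j \<in> J \<and> i \<in> J \<and> j < i}"
  have "koszul_diff k (koszul_diff k c) J = (\<Sum>j\<in>J. \<Sum>i\<in>J - {j}. f j i)"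
    unfolding koszul_diff_def f_def scale_sum_right by (simp add: mult_ac)
  also have "\<dots> = (\<Sum>(j, i)\<in>(SIGMA j:J. J - {j}). f j i)"
    using assms by (intro sum.Sigma) auto
  also have "(SIGMA j:J. J - {j}) = P \<union> P'"
    unfolding P_def P'_def by auto
  also have "(\<Sum>(j, i)\<in>P \<union> P'. f j i) = (\<Sum>(j, i)\<in>P. f j i) + (\<Sum>(j, i)\<in>P'. f j i)"
  proof (rule sum.union_disjoint)
    have "P \<subseteq> J \<times> J" "P' \<subseteq> J \<times> J" unfolding P_def P'_def by auto
    then show "finite P" "finite P'"
      using assms finite_subset finite_cartesian_product by metis+
  qed (auto simp: P_def P'_def)
  also have "(\<Sum>(j, i)\<in>P'. f j i) = (\<Sum>(j, i)\<in>P. f i j)"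
    by (rule sum.reindex_bij_witness[of _ prod.swap prod.swap]) (auto simp: P_def P'_def)
  also have "\<dots> = (\<Sum>(j, i)\<in>P. - f j i)"
    by (rule sum.cong[OF refl]) (auto simp: P_def intro!: swap)
  finally show ?thesis
    by (simp add: case_prod_unfold sum_negf)
qed

text \<open>The contracting homotopy of the localization at \<open>x j\<close>, with denominators cleared.\<close>

definition koszul_homotopy :: "nat \<Rightarrow> (nat set \<Rightarrow> 'm) \<Rightarrow> nat set \<Rightarrow> 'm" where
  "koszul_homotopy j c I = (if j \<in> I then 0 else scale (koszul_sign (insert j I) j) (c (insert j I)))"

text \<open>Multiplication by \<open>x j ^ k\<close> is null-homotopic. For \<open>j \<in> J\<close>
  only the summand that removes \<open>j\<close> survives; otherwise the mixed summands cancel by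
  their signs, and removing \<open>j\<close> from \<open>insert j J\<close> leaves the right-hand
  side.\<close>

lemma koszul_homotopy:
  assumes "finite J"
  shows "koszul_diff k (koszul_homotopy j c) J + koszul_homotopy j (koszul_diff k c) J =
    scale (x j ^ k) (c J)"
proof (cases "j \<in> J")
  case True
  have "koszul_diff k (koszul_homotopy j c) J =
    (\<Sum>i\<in>J. if i = j then scale (x j ^ k) (c J) else 0)"
    unfolding koszul_diff_def
  proof (rule sum.cong[OF refl])
    fix i assume "i \<in> J"
    show "scale (koszul_sign J i * x i ^ k) (koszul_homotopy j c (J - {i})) =
      (if i = j then scale (x j ^ k) (c J) else 0)"
    proof (cases "i = j")
      case True
      have "koszul_sign J j * x j ^ k * koszul_sign J j = (koszul_sign J j * koszul_sign J j) * x j ^ k"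
        by (simp only: mult_ac)
      with True \<open>j \<in> J\<close> show ?thesis
        by (simp add: koszul_homotopy_def insert_absorb koszul_sign_square)
    qed (use True in \<open>simp add: koszul_homotopy_def\<close>)
  qed
  with True assms show ?thesis
    by (simp add: koszul_homotopy_def)
next
  case False
  let ?L = "insert j J"
  have "koszul_homotopy j (koszul_diff k c) J =
    scale (koszul_sign ?L j * (koszul_sign ?L j * x j ^ k)) (c (?L - {j})) +
    (\<Sum>i\<in>J. scale (koszul_sign ?L j * (koszul_sign ?L i * x i ^ k)) (c (?L - {i})))"
    using False assms by (simp add: koszul_homotopy_def koszul_diff_def scale_right_distrib scale_sum_right)
  also have "scale (koszul_sign ?L j * (koszul_sign ?L j * x j ^ k)) (c (?L - {j})) = scale (x j ^ k) (c J)"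
    using False koszul_sign_square[of ?L j, where ?'a = 'r] by (simp add: mult.assoc[symmetric])
  also have "(\<Sum>i\<in>J. scale (koszul_sign ?L j * (koszul_sign ?L i * x i ^ k)) (c (?L - {i}))) =
    (\<Sum>i\<in>J. - scale (koszul_sign J i * x i ^ k) (koszul_homotopy j c (J - {i})))"
  proof (rule sum.cong[OF refl])
    fix i assume i: "i \<in> J"
    have L: "finite ?L" "i \<in> ?L" "j \<in> ?L" "i \<noteq> j" "?L - {j} = J" "insert j (J - {i}) = ?L - {i}"
      using False assms i by auto
    have "koszul_sign ?L j * koszul_sign ?L i =
      - ((koszul_sign J i * koszul_sign (?L - {i}) j) :: 'r)"
      unfolding koszul_sign_remove[OF L(1,2), of j] koszul_sign_remove[OF L(1,3), of i] L(5)
      by (cases i j rule: linorder_cases) (use L(4) in \<open>simp_all add: mult.commute\<close>)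
    then have "koszul_sign ?L j * (koszul_sign ?L i * x i ^ k) =
      - (koszul_sign J i * koszul_sign (?L - {i}) j) * x i ^ k"
      by (simp only: mult.assoc[symmetric])
    then have "koszul_sign ?L j * (koszul_sign ?L i * x i ^ k) =
      - (koszul_sign J i * x i ^ k * koszul_sign (?L - {i}) j)"
      by (simp only: mult_minus_left mult_minus_right mult_ac)
    then show "scale (koszul_sign ?L j * (koszul_sign ?L i * x i ^ k)) (c (?L - {i})) =
      - scale (koszul_sign J i * x i ^ k) (koszul_homotopy j c (J - {i}))"
      using False L by (simp add: koszul_homotopy_def)
  qed
  finally show ?thesis
    by (simp add: koszul_diff_def[of k "koszul_homotopy j c" J] sum_negf)
qed

lemma koszul_cochains_scale:
  assumes "c \<in> koszul_cochains p k t" "a \<in> R m"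
  shows "(\<lambda>I. scale a (c I)) \<in> koszul_cochains p k (t + int m)"
  using assms unfolding koszul_cochains_def by (auto intro!: scale_int_mem[OF assms(2)])

lemma koszul_cochains_diff:
  assumes "b \<in> koszul_cochains p k t" "c \<in> koszul_cochains p k t"
  shows "(\<lambda>I. b I - c I) \<in> koszul_cochains p k t"
  using assms unfolding koszul_cochains_def by (auto intro: module_grading_intros)

lemma koszul_cochains_zero: "(\<lambda>I. 0) \<in> koszul_cochains p k t"
  unfolding koszul_cochains_def by (auto intro: module_grading_intros)

text \<open>By the homotopy each \<open>x j ^ k\<close> kills the class of \<open>c\<close> modulo
  \<open>N\<close>, and \<open>z\<close> lies in the ideal generated by the \<open>x j\<close>, so a
  power of \<open>z\<close> kills the class too.\<close>

lemma koszul_cocycle_torsion: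
  assumes N: "homogeneous N" and z: "z \<in> R 1"
    and c: "c \<in> koszul_cochains p k t" "koszul_cocycle N p k c"
  shows "\<exists>K. koszul_coboundary N p k (t + int K) (\<lambda>I. scale (z ^ K) (c I))"
proof -
  interpret ring: Modules.module "(*) :: 'r \<Rightarrow> 'r \<Rightarrow> 'r"
    by unfold_locales (auto simp: algebra_simps)
  have sub: "subspace N"
    using N unfolding homogeneous_def by blast
  \<comment> \<open>The ideal of all scalars annihilating the cohomology class of \<open>c\<close>.\<close>
  define A where "A = {f. \<exists>b. \<forall>I\<in>index_sets p. scale f (c I) - koszul_diff k b I \<in> N}"
  have "ring.subspace A"
  proof (rule ring.subspaceI)
    have "\<forall>I\<in>index_sets p. scale 0 (c I) - koszul_diff k (\<lambda>I. 0) I \<in> N"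
      using subspace_0[OF sub] by (simp add: koszul_diff_zero)
    then show "0 \<in> A"
      unfolding A_def by blast
  next
    fix f g assume "f \<in> A" "g \<in> A"
    then obtain b b' where b: "\<forall>I\<in>index_sets p. scale f (c I) - koszul_diff k b I \<in> N"
      "\<forall>I\<in>index_sets p. scale g (c I) - koszul_diff k b' I \<in> N"
      unfolding A_def by blast
    have "scale (f + g) (c I) - koszul_diff k (\<lambda>I. b I + b' I) I =
      (scale f (c I) - koszul_diff k b I) + (scale g (c I) - koszul_diff k b' I)" for I
      by (simp add: koszul_diff_add scale_left_distrib)
    then have "\<forall>I\<in>index_sets p. scale (f + g) (c I) - koszul_diff k (\<lambda>I. b I + b' I) I \<in> N"
      using b subspace_add[OF sub] by simp
    then show "f + g \<in> A"
      unfolding A_def by blast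
  next
    fix f g assume "g \<in> A"
    then obtain b where b: "\<forall>I\<in>index_sets p. scale g (c I) - koszul_diff k b I \<in> N"
      unfolding A_def by blast
    have "scale (f * g) (c I) - koszul_diff k (\<lambda>I. scale f (b I)) I =
      scale f (scale g (c I) - koszul_diff k b I)" for I
      by (simp add: koszul_diff_scale scale_right_diff_distrib)
    then have "\<forall>I\<in>index_sets p. scale (f * g) (c I) - koszul_diff k (\<lambda>I. scale f (b I)) I \<in> N"
      using b subspace_scale[OF sub] by simp
    then show "f * g \<in> A"
      unfolding A_def by blast
  qed
  moreover have "z \<in> ideal_gen (x ` {..<n})"
    using z x_generate by blast
  moreover have "g ^ k \<in> A" if "g \<in> x ` {..<n}" for g
  proof -
    obtain j where j: "j < n" "g = x j"
      using \<open>g \<in> x ` {..<n}\<close> by blast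
    have "scale (x j ^ k) (c I) - koszul_diff k (koszul_homotopy j c) I \<in> N"
      if I: "I \<in> index_sets p" for I
    proof -
      have "scale (x j ^ k) (c I) - koszul_diff k (koszul_homotopy j c) I =
        koszul_homotopy j (koszul_diff k c) I"
        using koszul_homotopy[OF finite_index[OF I], of k j c] by (simp add: algebra_simps)
      also have "\<dots> \<in> N"
        using c(2) index_sets_insert[OF I _ j(1)] subspace_0[OF sub] subspace_scale[OF sub]
        unfolding koszul_homotopy_def koszul_cocycle_def by auto
      finally show ?thesis .
    qed
    then show ?thesis
      unfolding A_def j(2) by blast
  qed
  ultimately obtain K where "z ^ K \<in> A"
    using power_mem_ideal_of_generators by blast
  then obtain b where b: "\<And>I. I \<in> index_sets p \<Longrightarrow> scale (z ^ K) (c I) - koszul_diff k b I \<in> N"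
    unfolding A_def by blast
  have zK: "z ^ K \<in> R K"
    using power_mem[OF z, of K] by simp
  \<comment> \<open>Membership in \<open>A\<close> provides \<open>b\<close> without any control of
    degrees. Since \<open>N\<close> is homogeneous and \<open>c\<close> is a homogeneous cochain,
    the relation survives projection to the right degree.\<close>
  define b' where "b' I = hom_component M (t + int K + int k * (p - 1)) (b I)" for I
  have "b' \<in> koszul_cochains (p - 1) k (t + int K)"
    unfolding koszul_cochains_def b'_def using hom_component_mem[OF module_grading] by blast
  moreover have "scale (z ^ K) (c I) - koszul_diff k b' I \<in> N" if I: "I \<in> index_sets p" for I
  proof -
    have "scale (koszul_sign I j * x j ^ k) (b' (I - {j})) =
      hom_component M (t + int K + int k * p) (scale (koszul_sign I j * x j ^ k) (b (I - {j})))"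
      if "j \<in> I" for j
    proof -
      have "koszul_sign I j = (1 :: 'r) \<or> koszul_sign I j = (- 1 :: 'r)"
        unfolding koszul_sign_def by (metis neg_one_even_power neg_one_odd_power)
      then have "koszul_sign I j * x j ^ k = x j ^ k \<or> koszul_sign I j * x j ^ k = - (x j ^ k)"
        by auto
      moreover have "j < n"
        using that I unfolding index_sets_def by auto
      then have "hom_component M (int k + (t + int K + int k * (p - 1))) (scale (x j ^ k) (b (I - {j}))) =
        scale (x j ^ k) (b' (I - {j}))"
        unfolding b'_def by (intro hom_component_scale x_power_mem)
      moreover have "int k + (t + int K + int k * (p - 1)) = t + int K + int k * p"
        by (simp add: algebra_simps)
      ultimately show ?thesis
        by (auto simp: hom_component_uminus[OF module_grading])
    qed
    then have "koszul_diff k b' I = hom_component M (t + int K + int k * p) (koszul_diff k b I)"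
      unfolding koszul_diff_def hom_component_sum_right[OF module_grading] by simp
    moreover have "scale (z ^ K) (c I) = hom_component M (t + int K + int k * p) (scale (z ^ K) (c I))"
      using c(1) I zK unfolding koszul_cochains_def
      by (intro hom_component_id[OF module_grading, symmetric] scale_int_mem[OF zK]) auto
    ultimately have "scale (z ^ K) (c I) - koszul_diff k b' I =
      hom_component M (t + int K + int k * p) (scale (z ^ K) (c I) - koszul_diff k b I)"
      by (simp add: hom_component_diff[OF module_grading])
    then show ?thesis
      using b[OF I] N unfolding homogeneous_def by simp
  qed
  ultimately show ?thesis
    unfolding koszul_coboundary_def
    by (intro exI[of _ K] exI[of _ 0] bexI[of _ b']) (auto simp: raise_level_0)
qed

text \<open>\<open>reg (M/N) \<le> r\<close>, where negative \<open>p\<close> do no harm since they admit no index sets.\<close>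

definition reg_le :: "'m set \<Rightarrow> real \<Rightarrow> bool" where
  "reg_le N r \<longleftrightarrow> (\<forall>p t. r < of_int (t + p) \<longrightarrow> cohomology_vanishes N p t)"

section \<open>Diagram chases for multiplication by a linear form\<close>

lemma cohomology_vanishes_negative: "p < 0 \<Longrightarrow> cohomology_vanishes N p t"
  unfolding cohomology_vanishes_def koszul_coboundary_def
  using koszul_cochains_zero index_sets_negative by blast

text \<open>Each further level raises the degree of the numerators by \<open>p\<close>. For
  \<open>p = 0\<close> nothing moves, whence the separate premise.\<close>

lemma degree_shift_exceeds:
  fixes t p :: int
  assumes "0 \<le> p" "p = 0 \<Longrightarrow> r < real_of_int t"
  shows "\<exists>l. \<forall>m\<ge>l. r < real_of_int (t + int (k + m) * p)"
proof (cases "p = 0")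
  case False
  then have p: "1 \<le> p"
    using assms(1) by simp
  \<comment> \<open>The summand 1 makes the inequality strict.\<close>
  have "r < real_of_int (t + int (k + m) * p)" if "nat \<lceil>r - t\<rceil> + 1 \<le> m" for m
  proof -
    have "r - t < real (k + m)"
      using that by linarith
    also have "\<dots> \<le> real (k + m) * real_of_int p"
      using p by (simp add: mult_le_cancel_left1)
    finally show ?thesis
      by simp
  qed
  then show ?thesis
    by blast
qed (use assms in auto)

text \<open>Modulo \<open>N\<close> and up to levels, let \<open>z c = d b\<close>. Then
  \<open>b\<close> is a cocycle modulo N + zM, hence \<open>b = d b' + z e\<close> there, so
  \<open>z (c - d e)\<close> lies in \<open>N\<close>. Cancelling \<open>z\<close> in high degrees
  exhibits \<open>c\<close> as the coboundary of \<open>e\<close>.\<close>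

lemma cohomology_step_injective:
  assumes N: "homogeneous N" and z: "z \<in> R 1" and p: "0 \<le> p" "r < of_int (t + p)"
    and colon: "\<And>u t. r < of_int t \<Longrightarrow> u \<in> M t \<Longrightarrow> scale z u \<in> N \<Longrightarrow> u \<in> N"
    and reg: "reg_le (add_multiples z N) r"
    and c: "c \<in> koszul_cochains p k t"
    and cob: "koszul_coboundary N p k (t + 1) (\<lambda>I. scale z (c I))"
  shows "koszul_coboundary N p k t c"
proof -
  let ?N' = "add_multiples z N"
  have sub: "subspace N"
    using N unfolding homogeneous_def by blast
  obtain l b where b: "b \<in> koszul_cochains (p - 1) (k + l) (t + 1)"
    and zc: "\<And>I. I \<in> index_sets p \<Longrightarrow> raise_level l (\<lambda>I. scale z (c I)) I - koszul_diff (k + l) b I \<in> N"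
    using cob unfolding koszul_coboundary_def by blast
  have "koszul_cocycle ?N' (p - 1) (k + l) b"
    unfolding koszul_cocycle_def
  proof
    fix I assume "I \<in> index_sets (p - 1 + 1)"
    then have "I \<in> index_sets p" by simp
    define u where "u = raise_level l (\<lambda>I. scale z (c I)) I - koszul_diff (k + l) b I"
    have "koszul_diff (k + l) b I = - u + scale z (raise_level l c I)"
      by (simp add: u_def raise_level_def mult.commute)
    moreover have "- u \<in> N"
      unfolding u_def using zc[OF \<open>I \<in> index_sets p\<close>] by (rule subspace_neg[OF sub])
    ultimately show "koszul_diff (k + l) b I \<in> ?N'"
      unfolding add_multiples_def by blast
  qed
  \<comment> \<open>The total degree \<open>(p - 1) + (t + 1)\<close> equals \<open>t + p\<close>,
    so the same bound \<open>r\<close> applies.\<close>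
  moreover have "cohomology_vanishes ?N' (p - 1) (t + 1)"
    using reg p(2) unfolding reg_le_def by simp
  ultimately have "koszul_coboundary ?N' (p - 1) (k + l) (t + 1) b"
    using b unfolding cohomology_vanishes_def by blast
  then obtain m b' where b': "b' \<in> koszul_cochains (p - 1 - 1) (k + l + m) (t + 1)"
    and bb': "\<And>I. I \<in> index_sets (p - 1) \<Longrightarrow> raise_level m b I - koszul_diff (k + l + m) b' I \<in> ?N'"
    unfolding koszul_coboundary_def by blast
  let ?K = "k + l + m"
  have diff: "(\<lambda>I. raise_level m b I - koszul_diff ?K b' I) \<in> koszul_cochains (p - 1) ?K (t + 1)"
    using koszul_cochains_diff[OF raise_level_mem[OF b, of m] koszul_diff_mem[OF b', simplified]] by simp
  have "\<exists>e. raise_level m b I - koszul_diff ?K b' I - scale z e \<in> N \<and> e \<in> M (t + int ?K * (p - 1))"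
    if I: "I \<in> index_sets (p - 1)" for I
  proof -
    have "raise_level m b I - koszul_diff ?K b' I \<in> M (t + 1 + int ?K * (p - 1))"
      using diff I unfolding koszul_cochains_def by blast
    then obtain e where "raise_level m b I - koszul_diff ?K b' I - scale z e \<in> N"
      "e \<in> M (t + 1 + int ?K * (p - 1) - 1)"
      using add_multiples_homogeneous_cases[OF N z bb'[OF I]] by metis
    then show ?thesis
      by (intro exI[of _ e]) (simp add: algebra_simps)
  qed
  then obtain e where e: "\<And>I. I \<in> index_sets (p - 1) \<Longrightarrow>
      raise_level m b I - koszul_diff ?K b' I - scale z (e I) \<in> N \<and> e I \<in> M (t + int ?K * (p - 1))"
    by metis
  have e_mem: "e \<in> koszul_cochains (p - 1) ?K t"
    unfolding koszul_cochains_def using e by blast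
  define w where "w I = raise_level (l + m) c I - koszul_diff ?K e I" for I
  have w_mem: "w \<in> koszul_cochains p ?K t"
    unfolding w_def
    using raise_level_mem[OF c, of "l + m"] koszul_diff_mem[OF e_mem]
    by (intro koszul_cochains_diff) (simp_all add: add.assoc)
  have zw: "scale z (w I) \<in> N" if I: "I \<in> index_sets p" for I
  proof -
    have "koszul_diff ?K (\<lambda>I. raise_level m b I - koszul_diff ?K b' I - scale z (e I)) I \<in> N"
      using e index_sets_remove[OF I] by (intro koszul_diff_subspace[OF sub]) auto
    then have "raise_level m (koszul_diff (k + l) b) I - scale z (koszul_diff ?K e I) \<in> N"
      unfolding koszul_diff_diff koszul_diff_scale koszul_diff_koszul_diff[OF finite_index[OF I]]
        raise_level_koszul_diff[OF finite_index[OF I], symmetric] by simp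
    moreover have "scale (prod x I ^ m) (raise_level l (\<lambda>I. scale z (c I)) I - koszul_diff (k + l) b I) \<in> N"
      using zc[OF I] subspace_scale[OF sub] by blast
    ultimately have "raise_level m (koszul_diff (k + l) b) I - scale z (koszul_diff ?K e I) +
      scale (prod x I ^ m) (raise_level l (\<lambda>I. scale z (c I)) I - koszul_diff (k + l) b I) \<in> N"
      using subspace_add[OF sub] by blast
    also have "raise_level m (koszul_diff (k + l) b) I - scale z (koszul_diff ?K e I) +
      scale (prod x I ^ m) (raise_level l (\<lambda>I. scale z (c I)) I - koszul_diff (k + l) b I) = scale z (w I)"
      by (simp add: raise_level_def w_def scale_right_diff_distrib power_add mult_ac)
    finally show ?thesis .
  qed
  \<comment> \<open>\<open>z\<close> may be cancelled only in degrees above \<open>r\<close>;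
    raising the level reaches them if \<open>p > 0\<close>, and for \<open>p = 0\<close> the degree
    \<open>t\<close> is already above \<open>r\<close>.\<close>
  obtain q where q: "r < real_of_int (t + int (?K + q) * p)"
    using degree_shift_exceeds[of p r t ?K] p by auto
  have "raise_level q w I \<in> N" if I: "I \<in> index_sets p" for I
  proof (rule colon[OF q])
    show "raise_level q w I \<in> M (t + int (?K + q) * p)"
      using raise_level_mem[OF w_mem, of q] I unfolding koszul_cochains_def by blast
    have "scale z (raise_level q w I) = scale (prod x I ^ q) (scale z (w I))"
      by (simp add: raise_level_def mult.commute)
    then show "scale z (raise_level q w I) \<in> N"
      using subspace_scale[OF sub zw[OF I]] by simp
  qed
  moreover have "raise_level q w I = raise_level (l + m + q) c I - koszul_diff (?K + q) (raise_level q e) I"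
    if I: "I \<in> index_sets p" for I
    unfolding raise_level_koszul_diff[OF finite_index[OF I], symmetric] raise_level_raise_level[symmetric]
    by (simp add: raise_level_def w_def scale_right_diff_distrib power_add mult.commute)
  ultimately have "\<forall>I\<in>index_sets p. raise_level (l + m + q) c I - koszul_diff (k + (l + m + q)) (raise_level q e) I \<in> N"
    by (simp add: add.assoc)
  moreover have "raise_level q e \<in> koszul_cochains (p - 1) (k + (l + m + q)) t"
    using raise_level_mem[OF e_mem, of q] by (simp add: add.assoc)
  ultimately show ?thesis
    unfolding koszul_coboundary_def by blast
qed

text \<open>Induction on the exponent \<open>K\<close> with \<open>z ^ K\<close> killing the class:
  passing from \<open>c\<close> to \<open>z c\<close> raises the total degree, which therefore stays
  above \<open>r\<close>, and injectivity of \<open>z\<close> brings the conclusion back to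
  \<open>c\<close>.\<close>

lemma reg_le_if_quotient:
  assumes N: "homogeneous N" and z: "z \<in> R 1"
    and colon: "\<And>u t. r < of_int t \<Longrightarrow> u \<in> M t \<Longrightarrow> scale z u \<in> N \<Longrightarrow> u \<in> N"
    and reg: "reg_le (add_multiples z N) r"
  shows "reg_le N r"
  unfolding reg_le_def
proof (intro allI impI)
  fix p t assume pt: "r < real_of_int (t + p)"
  show "cohomology_vanishes N p t"
  proof (cases "0 \<le> p")
    case True
    have "koszul_coboundary N p k t c"
      if "c \<in> koszul_cochains p k t" "koszul_coboundary N p k (t + int K) (\<lambda>I. scale (z ^ K) (c I))"
        "r < real_of_int (t + p)" for k t c K
      using that
    proof (induction K arbitrary: t c)
      case (Suc K)
      have "(\<lambda>I. scale z (c I)) \<in> koszul_cochains p k (t + 1)"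
        using koszul_cochains_scale[OF Suc.prems(1) z] by simp
      moreover have "koszul_coboundary N p k (t + 1 + int K) (\<lambda>I. scale (z ^ K) (scale z (c I)))"
        using Suc.prems(2) by (simp add: algebra_simps)
      ultimately have step: "koszul_coboundary N p k (t + 1) (\<lambda>I. scale z (c I))"
        using Suc.IH[of "\<lambda>I. scale z (c I)" "t + 1"] Suc.prems(3) by simp
      show ?case
        by (rule cohomology_step_injective[OF N z True Suc.prems(3) _ reg Suc.prems(1) step]) (rule colon)
    qed simp
    then show ?thesis
      unfolding cohomology_vanishes_def using koszul_cocycle_torsion[OF N z] pt by blast
  qed (use cohomology_vanishes_negative in simp)
qed

text \<open>The multiples \<open>x j ^ k * u\<close> are killed by \<open>z\<close> modulo
  \<open>N\<close> and have degree at least \<open>t0\<close>, so they lie in \<open>N\<close>. Thus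
  \<open>u\<close> is a cocycle in degree 0, and vanishing there means \<open>u \<in> N\<close>, as
  seen at the empty index set, where the product is 1 and the differential is 0.\<close>

lemma colon_le_if_reg_le:
  assumes N: "subspace N"
    and filter: "\<And>u t. t0 \<le> t \<Longrightarrow> u \<in> M t \<Longrightarrow> scale z u \<in> N \<Longrightarrow> u \<in> N"
    and reg: "reg_le N r"
    and t: "r < of_int t" and u: "u \<in> M t" "scale z u \<in> N"
  shows "u \<in> N"
proof -
  define k where "k = nat \<bar>t0 - t\<bar>"
  have "(\<lambda>_. u) \<in> koszul_cochains 0 k t"
    unfolding koszul_cochains_def using u(1) by simp
  moreover have "koszul_cocycle N 0 k (\<lambda>_. u)"
    unfolding koszul_cocycle_def
  proof
    fix J assume J: "J \<in> index_sets (0 + 1)"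
    have "scale (x j ^ k) u \<in> N" if "j \<in> J" for j
    proof (rule filter)
      show "t0 \<le> t + int k"
        unfolding k_def by simp
      have "j < n"
        using J that unfolding index_sets_def by auto
      then show "scale (x j ^ k) u \<in> M (t + int k)"
        using scale_mem[OF x_power_mem u(1)] by (simp add: add.commute)
      show "scale z (scale (x j ^ k) u) \<in> N"
        using subspace_scale[OF N u(2), of "x j ^ k"] by (simp add: mult.commute)
    qed
    then show "koszul_diff k (\<lambda>_. u) J \<in> N"
      unfolding koszul_diff_def scale_scale[symmetric]
      using subspace_scale[OF N] by (intro subspace_sum[OF N]) blast
  qed
  moreover have "cohomology_vanishes N 0 t"
    using reg t unfolding reg_le_def by simp
  ultimately obtain l b where
    "\<forall>I\<in>index_sets 0. raise_level l (\<lambda>_. u) I - koszul_diff (k + l) b I \<in> N"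
    unfolding cohomology_vanishes_def koszul_coboundary_def by blast
  moreover have "{} \<in> index_sets 0"
    unfolding index_sets_def by simp
  ultimately have "raise_level l (\<lambda>_. u) {} - koszul_diff (k + l) b {} \<in> N"
    by blast
  then show ?thesis
    by (simp add: raise_level_def koszul_diff_def)
qed

text \<open>For a cocycle \<open>c\<close> modulo N + zM, write \<open>d c = z e\<close> modulo
  \<open>N\<close>. After raising the level \<open>e\<close> is a cocycle modulo \<open>N\<close> of
  the same total degree, hence \<open>e = d b\<close>. Then \<open>c - z b\<close> is a cocycle, so
  a coboundary, modulo \<open>N\<close>, and it agrees with \<open>c\<close> modulo N + zM.\<close>

lemma reg_le_quotient:
  assumes N: "homogeneous N" and z: "z \<in> R 1"
    and filter: "\<And>u t. t0 \<le> t \<Longrightarrow> u \<in> M t \<Longrightarrow> scale z u \<in> N \<Longrightarrow> u \<in> N"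
    and reg: "reg_le N r"
  shows "reg_le (add_multiples z N) r"
  unfolding reg_le_def
proof (intro allI impI)
  let ?N' = "add_multiples z N"
  have sub: "subspace N"
    using N unfolding homogeneous_def by blast
  have sub': "subspace ?N'"
    using subspace_add_multiples[OF sub] .
  have N_N': "u + scale z v \<in> ?N'" if "u \<in> N" for u v
    unfolding add_multiples_def using that by blast
  fix p t assume pt: "r < real_of_int (t + p)"
  show "cohomology_vanishes ?N' p t"
  proof (cases "0 \<le> p")
    case True
    have "koszul_coboundary ?N' p k t c"
      if c: "c \<in> koszul_cochains p k t" "koszul_cocycle ?N' p k c" for k c
    proof -
      have "\<exists>e. koszul_diff k c J - scale z e \<in> N \<and> e \<in> M (t - 1 + int k * (p + 1))"
        if J: "J \<in> index_sets (p + 1)" for J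
      proof -
        have "koszul_diff k c J \<in> M (t + int k * (p + 1))"
          using koszul_diff_mem[OF c(1)] J unfolding koszul_cochains_def by blast
        moreover have "koszul_diff k c J \<in> ?N'"
          using c(2) J unfolding koszul_cocycle_def by blast
        ultimately obtain e where "koszul_diff k c J - scale z e \<in> N" "e \<in> M (t + int k * (p + 1) - 1)"
          using add_multiples_homogeneous_cases[OF N z] by metis
        then show ?thesis
          by (intro exI[of _ e]) (simp add: algebra_simps)
      qed
      then obtain e where e: "\<And>J. J \<in> index_sets (p + 1) \<Longrightarrow>
          koszul_diff k c J - scale z (e J) \<in> N \<and> e J \<in> M (t - 1 + int k * (p + 1))"
        by metis
      have e_mem: "e \<in> koszul_cochains (p + 1) k (t - 1)"
        unfolding koszul_cochains_def using e by blast
      \<comment> \<open>At first only \<open>z * d e\<close> is known to lie in \<open>N\<close>.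
        Since \<open>d e\<close> lives in the positive cohomological degree
        \<open>p + 1 + 1\<close>, its numerators can always be moved beyond \<open>t0\<close>, where
        \<open>z\<close> cancels.\<close>
      obtain l where l: "\<And>m. l \<le> m \<Longrightarrow> real_of_int t0 < real_of_int (t - 1 + int (k + m) * (p + 1 + 1))"
        using degree_shift_exceeds[of "p + 1 + 1" "real_of_int t0" "t - 1" k] True by auto
      have "koszul_cocycle N (p + 1) (k + l) (raise_level l e)"
        unfolding koszul_cocycle_def
      proof
        fix J assume J: "J \<in> index_sets (p + 1 + 1)"
        show "koszul_diff (k + l) (raise_level l e) J \<in> N"
        proof (rule filter)
          show "t0 \<le> t - 1 + int (k + l) * (p + 1 + 1)"
            using l[of l] by linarith
          show "koszul_diff (k + l) (raise_level l e) J \<in> M (t - 1 + int (k + l) * (p + 1 + 1))"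
            using koszul_diff_mem[OF raise_level_mem[OF e_mem, of l]] J unfolding koszul_cochains_def by blast
          have "J - {j} \<in> index_sets (p + 1)" if "j \<in> J" for j
            using index_sets_remove[OF J that] by (simp only: add_diff_cancel_right')
          then have "koszul_diff k (\<lambda>J. koszul_diff k c J - scale z (e J)) J \<in> N"
            using e by (intro koszul_diff_subspace[OF sub]) blast
          then have "- koszul_diff k (\<lambda>J. koszul_diff k c J - scale z (e J)) J \<in> N"
            by (rule subspace_neg[OF sub])
          then have "scale z (koszul_diff k e J) \<in> N"
            unfolding koszul_diff_diff koszul_diff_scale koszul_diff_koszul_diff[OF finite_index[OF J]]
            by simp
          then have "scale (prod x J ^ l) (scale z (koszul_diff k e J)) \<in> N"
            by (rule subspace_scale[OF sub])
          then show "scale z (koszul_diff (k + l) (raise_level l e) J) \<in> N"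
            unfolding raise_level_koszul_diff[OF finite_index[OF J], symmetric]
            by (simp add: raise_level_def mult.commute)
        qed
      qed
      moreover have "cohomology_vanishes N (p + 1) (t - 1)"
        using reg pt unfolding reg_le_def by simp
      ultimately obtain m b where b: "b \<in> koszul_cochains (p + 1 - 1) (k + l + m) (t - 1)"
        "\<And>J. J \<in> index_sets (p + 1) \<Longrightarrow> raise_level m (raise_level l e) J - koszul_diff (k + l + m) b J \<in> N"
        using raise_level_mem[OF e_mem, of l]
        unfolding cohomology_vanishes_def koszul_coboundary_def by blast
      define c' where "c' I = raise_level (l + m) c I - scale z (b I)" for I
      have "(\<lambda>I. scale z (b I)) \<in> koszul_cochains p (k + (l + m)) t"
        using koszul_cochains_scale[OF b(1) z] by (simp add: add.assoc)
      then have "c' \<in> koszul_cochains p (k + (l + m)) t"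
        unfolding c'_def using koszul_cochains_diff raise_level_mem[OF c(1)] by blast
      moreover have "koszul_cocycle N p (k + (l + m)) c'"
        unfolding koszul_cocycle_def
      proof
        fix J assume J: "J \<in> index_sets (p + 1)"
        have "koszul_diff (k + (l + m)) c' J =
          scale (prod x J ^ (l + m)) (koszul_diff k c J - scale z (e J)) +
          scale z (raise_level m (raise_level l e) J - koszul_diff (k + l + m) b J)"
          unfolding c'_def koszul_diff_diff koszul_diff_scale raise_level_raise_level
            raise_level_koszul_diff[OF finite_index[OF J], symmetric]
          by (simp add: raise_level_def scale_right_diff_distrib mult.commute add.assoc)
        also have "\<dots> \<in> N"
          using e[OF J] b(2)[OF J] by (intro subspace_add[OF sub] subspace_scale[OF sub]) auto
        finally show "koszul_diff (k + (l + m)) c' J \<in> N" .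
      qed
      moreover have "cohomology_vanishes N p t"
        using reg pt unfolding reg_le_def by blast
      ultimately obtain q d where d: "d \<in> koszul_cochains (p - 1) (k + (l + m) + q) t"
        "\<And>I. I \<in> index_sets p \<Longrightarrow> raise_level q c' I - koszul_diff (k + (l + m) + q) d I \<in> N"
        unfolding cohomology_vanishes_def koszul_coboundary_def by blast
      have "raise_level (l + m + q) c I - koszul_diff (k + (l + m + q)) d I \<in> ?N'"
        if I: "I \<in> index_sets p" for I
      proof -
        have "raise_level (l + m + q) c I - koszul_diff (k + (l + m + q)) d I =
          (raise_level q c' I - koszul_diff (k + (l + m) + q) d I) + scale z (scale (prod x I ^ q) (b I))"
          unfolding raise_level_raise_level[symmetric]
          by (simp add: raise_level_def c'_def scale_right_diff_distrib mult.commute add.assoc power_add)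
        then show ?thesis
          by (simp only: N_N'[OF d(2)[OF I]])
      qed
      then show ?thesis
        unfolding koszul_coboundary_def using d(1)
        by (intro exI[of _ "l + m + q"] bexI[of _ d]) (auto simp: add.assoc)
    qed
    then show ?thesis
      unfolding cohomology_vanishes_def by blast
  qed (use cohomology_vanishes_negative in simp)
qed

text \<open>If M/N vanishes in high degrees, cochains with \<open>p > 0\<close> die after raising
  the level, and the cohomology in degree 0 is M/N itself.\<close>

lemma reg_le_torsion:
  assumes N: "subspace N" and torsion: "\<And>t. t0 \<le> t \<Longrightarrow> M t \<subseteq> N"
  shows "reg_le N r \<longleftrightarrow> (\<forall>t. r < of_int t \<longrightarrow> M t \<subseteq> N)"
proof
  assume reg: "reg_le N r"
  have "u \<in> N" if "r < of_int t" "u \<in> M t" for u t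
    \<comment> \<open>With 0 in place of \<open>z\<close>, the colon condition holds for every
      element of \<open>M\<close>.\<close>
    using colon_le_if_reg_le[OF N _ reg that, of t0 0] torsion subspace_0[OF N] by auto
  then show "\<forall>t. r < of_int t \<longrightarrow> M t \<subseteq> N"
    by blast
next
  assume r: "\<forall>t. r < of_int t \<longrightarrow> M t \<subseteq> N"
  show "reg_le N r"
    unfolding reg_le_def
  proof (intro allI impI)
    fix p t assume pt: "r < real_of_int (t + p)"
    show "cohomology_vanishes N p t"
    proof (cases "0 \<le> p")
      case True
      show ?thesis
        unfolding cohomology_vanishes_def
      proof (intro allI ballI impI)
        fix k c assume c: "c \<in> koszul_cochains p k t"
        obtain l where l: "r < real_of_int (t + int (k + l) * p)"
          using degree_shift_exceeds[of p r t k] True pt by auto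
        have "raise_level l c I \<in> N" if "I \<in> index_sets p" for I
          using raise_level_mem[OF c, of l] that r l unfolding koszul_cochains_def by blast
        then have "\<forall>I\<in>index_sets p. raise_level l c I - koszul_diff (k + l) (\<lambda>_. 0) I \<in> N"
          by (simp add: koszul_diff_zero)
        then show "koszul_coboundary N p k t c"
          unfolding koszul_coboundary_def using koszul_cochains_zero by blast
      qed
    qed (use cohomology_vanishes_negative in simp)
  qed
qed

end

section \<open>Fractions with a common denominator\<close>

context Modules.module
begin

lemma scale_power_shift:
  assumes "scale (s ^ i) m = scale (s ^ j) m'"
  shows "scale (s ^ (i + e)) m = scale (s ^ (j + e)) m'"
proof -
  have "scale (s ^ e) (scale (s ^ i) m) = scale (s ^ e) (scale (s ^ j) m')"
    using assms by simp
  then show ?thesis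
    by (simp add: power_add mult.commute)
qed

lemma mem_loc_frac: "(m', k') \<in> loc_frac scale s m k \<longleftrightarrow> (\<exists>l. scale (s ^ (l + k')) m = scale (s ^ (l + k)) m')"
  by (simp add: loc_frac_def scale_right_diff_distrib power_add)

text \<open>Transitivity of equality of fractions: the two relations are multiplied by powers of
  \<open>s\<close> until their middle terms agree.\<close>

lemma loc_frac_subset:
  assumes "(m', k') \<in> loc_frac scale s m k"
  shows "loc_frac scale s m' k' \<subseteq> loc_frac scale s m k"
proof clarify
  fix u j assume "(u, j) \<in> loc_frac scale s m' k'"
  then obtain b where b: "scale (s ^ (b + j)) m' = scale (s ^ (b + k')) u"
    unfolding mem_loc_frac by blast
  obtain a where a: "scale (s ^ (a + k')) m = scale (s ^ (a + k)) m'"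
    using assms unfolding mem_loc_frac by blast
  have "scale (s ^ (a + b + k' + j)) m = scale (s ^ (a + b + k' + k)) u"
    using scale_power_shift[OF a, of "b + j"] scale_power_shift[OF b, of "a + k"]
    by (simp add: add_ac)
  then show "(u, j) \<in> loc_frac scale s m k"
    unfolding mem_loc_frac by blast
qed

lemma loc_frac_eq_iff:
  "loc_frac scale s m k = loc_frac scale s m' k' \<longleftrightarrow> (\<exists>l. scale (s ^ (l + k')) m = scale (s ^ (l + k)) m')"
proof
  assume "loc_frac scale s m k = loc_frac scale s m' k'"
  moreover have "(m', k') \<in> loc_frac scale s m' k'"
    unfolding mem_loc_frac by blast
  ultimately show "\<exists>l. scale (s ^ (l + k')) m = scale (s ^ (l + k)) m'"
    using mem_loc_frac by blast
next
  assume "\<exists>l. scale (s ^ (l + k')) m = scale (s ^ (l + k)) m'"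
  then have "(m', k') \<in> loc_frac scale s m k" "(m, k) \<in> loc_frac scale s m' k'"
    unfolding mem_loc_frac by metis+
  then show "loc_frac scale s m k = loc_frac scale s m' k'"
    using loc_frac_subset by blast
qed

lemma loc_frac_raise: "loc_frac scale s (scale (s ^ a) m) (k + a) = loc_frac scale s m k"
  unfolding loc_frac_eq_iff by (rule exI[of _ 0]) (simp add: power_add)

text \<open>Evaluates an operation on one representative: the union collapses once its members
  agree, because the fraction contains at least the pair \<open>(m, k)\<close>.\<close>

lemma UN_loc_frac:
  assumes "\<And>m' k'. (m', k') \<in> loc_frac scale s m k \<Longrightarrow> F m' k' = C"
  shows "(\<Union>(m', k')\<in>loc_frac scale s m k. F m' k') = C"
proof -
  have "(m, k) \<in> loc_frac scale s m k"
    unfolding mem_loc_frac by blast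
  then show ?thesis
    using assms by fastforce
qed

lemma localization_smult:
  "r \<odot>\<^bsub>localization scale s\<^esub> loc_frac scale s m k = loc_frac scale s (scale r m) k"
proof -
  have "loc_frac scale s (scale r m') k' = loc_frac scale s (scale r m) k"
    if m'k': "(m', k') \<in> loc_frac scale s m k" for m' k'
  proof -
    obtain l where "scale (s ^ (l + k')) m = scale (s ^ (l + k)) m'"
      using m'k' unfolding mem_loc_frac by blast
    then have "scale r (scale (s ^ (l + k)) m') = scale r (scale (s ^ (l + k')) m)"
      by simp
    then have "scale (s ^ (l + k)) (scale r m') = scale (s ^ (l + k')) (scale r m)"
      by (simp add: mult.commute)
    then show ?thesis
      unfolding loc_frac_eq_iff by blast
  qed
  then show ?thesis
    unfolding localization_def by (simp add: UN_loc_frac)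
qed

lemma loc_map_loc_frac:
  "loc_map scale s u (loc_frac scale s m k) = loc_frac scale (s * u) (scale (u ^ k) m) k"
  unfolding loc_map_def
proof (rule UN_loc_frac)
  fix m' k' assume "(m', k') \<in> loc_frac scale s m k"
  then obtain l where "scale (s ^ (l + k')) m = scale (s ^ (l + k)) m'"
    unfolding mem_loc_frac by blast
  then have "scale (u ^ (l + k + k')) (scale (s ^ (l + k)) m') = scale (u ^ (l + k + k')) (scale (s ^ (l + k')) m)"
    by simp
  then have "scale ((s * u) ^ (l + k)) (scale (u ^ k') m') = scale ((s * u) ^ (l + k')) (scale (u ^ k) m)"
    by (simp add: power_mult_distrib power_add mult_ac)
  then show "loc_frac scale (s * u) (scale (u ^ k') m') k' = loc_frac scale (s * u) (scale (u ^ k) m) k"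
    unfolding loc_frac_eq_iff by blast
qed

lemma localization_add:
  "loc_frac scale s m k \<oplus>\<^bsub>localization scale s\<^esub> loc_frac scale s m' k' =
     loc_frac scale s (scale (s ^ k') m + scale (s ^ k) m') (k + k')"
proof -
  have "loc_frac scale s (scale (s ^ j') u + scale (s ^ j) u') (j + j') =
      loc_frac scale s (scale (s ^ k') m + scale (s ^ k) m') (k + k')"
    if uj: "(u, j) \<in> loc_frac scale s m k" "(u', j') \<in> loc_frac scale s m' k'" for u j u' j'
  proof -
    obtain a b where a: "scale (s ^ (a + j)) m = scale (s ^ (a + k)) u"
      and b: "scale (s ^ (b + j')) m' = scale (s ^ (b + k')) u'"
      using uj unfolding mem_loc_frac by blast
    have "scale (s ^ (a + k + (b + k' + j'))) u = scale (s ^ (a + j + (b + k' + j'))) m"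
      using scale_power_shift[OF a] by simp
    moreover have "scale (s ^ (b + k' + (a + k + j))) u' = scale (s ^ (b + j' + (a + k + j))) m'"
      using scale_power_shift[OF b] by simp
    ultimately have "scale (s ^ (a + b + (k + k'))) (scale (s ^ j') u + scale (s ^ j) u') =
      scale (s ^ (a + b + (j + j'))) (scale (s ^ k') m + scale (s ^ k) m')"
      by (simp add: scale_right_distrib add_ac flip: power_add)
    then show ?thesis
      unfolding loc_frac_eq_iff by blast
  qed
  then show ?thesis
    unfolding localization_def by (simp add: UN_loc_frac)
qed

lemma localization_add_same:
  "loc_frac scale s m k \<oplus>\<^bsub>localization scale s\<^esub> loc_frac scale s m' k = loc_frac scale s (m + m') k"
  unfolding localization_add scale_right_distrib[symmetric] loc_frac_raise ..

lemma loc_frac_zero: "loc_frac scale s 0 k = loc_frac scale s 0 0"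
  unfolding loc_frac_eq_iff by simp

lemma localization_carrier: "loc_frac scale s m k \<in> carrier (localization scale s)"
  unfolding localization_def by auto

lemma localization_zero: "\<zero>\<^bsub>localization scale s\<^esub> = loc_frac scale s 0 k"
  unfolding localization_def by (simp add: loc_frac_zero[of s k])

lemma abelian_monoid_localization: "abelian_monoid (localization scale s)"
proof (rule abelian_monoidI)
  have carrierE: "\<exists>m k. a = loc_frac scale s m k" if "a \<in> carrier (localization scale s)" for a
    using that unfolding localization_def by auto
  show "\<zero>\<^bsub>localization scale s\<^esub> \<in> carrier (localization scale s)"
    unfolding localization_zero[of s 0] by (rule localization_carrier)
  fix a b assume a: "a \<in> carrier (localization scale s)" and b: "b \<in> carrier (localization scale s)"
  obtain m k where mk: "a = loc_frac scale s m k"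
    using carrierE[OF a] by blast
  obtain m' k' where mk': "b = loc_frac scale s m' k'"
    using carrierE[OF b] by blast
  show "a \<oplus>\<^bsub>localization scale s\<^esub> b \<in> carrier (localization scale s)"
    unfolding mk mk' localization_add by (rule localization_carrier)
  show "a \<oplus>\<^bsub>localization scale s\<^esub> b = b \<oplus>\<^bsub>localization scale s\<^esub> a"
    unfolding mk mk' localization_add by (simp add: add.commute)
  show "\<zero>\<^bsub>localization scale s\<^esub> \<oplus>\<^bsub>localization scale s\<^esub> a = a"
    unfolding mk localization_zero[of s k] localization_add_same by simp
  fix c assume c: "c \<in> carrier (localization scale s)"
  obtain m'' k'' where mk'': "c = loc_frac scale s m'' k''"
    using carrierE[OF c] by blast
  show "a \<oplus>\<^bsub>localization scale s\<^esub> b \<oplus>\<^bsub>localization scale s\<^esub> c =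
    a \<oplus>\<^bsub>localization scale s\<^esub> (b \<oplus>\<^bsub>localization scale s\<^esub> c)"
    unfolding mk mk' mk'' localization_add by (simp add: scale_right_distrib add_ac power_add mult_ac)
qed

lemma localization_finsum:
  assumes "finite A"
  shows "(\<Oplus>\<^bsub>localization scale s\<^esub>a\<in>A. loc_frac scale s (f a) k) = loc_frac scale s (\<Sum>a\<in>A. f a) k"
proof -
  interpret abelian_monoid "localization scale s"
    by (rule abelian_monoid_localization)
  show ?thesis
    using assms
  proof (induction A)
    case empty
    show ?case by (simp add: localization_zero[of s k])
  next
    case (insert a A)
    then show ?case
      by (simp add: finsum_insert localization_carrier localization_add_same)
  qed
qed

end

section \<open>Cech cochains as Koszul cochains over a common denominator\<close>

context graded_module_linear_forms
begin

lemma cech_index_eq: "cech_index n p = index_sets (int p)"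
  unfolding cech_index_def index_sets_def by simp

lemma finite_index_sets: "finite (index_sets p)"
  unfolding index_sets_def by (rule finite_subset[of _ "Pow {..<n}"]) auto

definition cech_of_koszul :: "int \<Rightarrow> nat \<Rightarrow> (nat set \<Rightarrow> 'm) \<Rightarrow> nat set \<Rightarrow> ('m \<times> nat) set" where
  "cech_of_koszul p k c = (\<lambda>I\<in>index_sets p. loc_frac scale (\<Prod>i\<in>I. x i) (c I) k)"

lemma cech_of_koszul_cong:
  "(\<And>I. I \<in> index_sets p \<Longrightarrow> b I = c I) \<Longrightarrow> cech_of_koszul p k b = cech_of_koszul p k c"
  unfolding cech_of_koszul_def by (intro restrict_ext) simp

lemma cech_of_koszul_raise_level: "cech_of_koszul p (k + l) (raise_level l c) = cech_of_koszul p k c"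
  unfolding cech_of_koszul_def raise_level_def loc_frac_raise ..

text \<open>Each index set has its own exponent witnessing equality of fractions; as there are
  finitely many index sets, one exponent serves them all.\<close>

lemma cech_of_koszul_eq_iff:
  "cech_of_koszul p k b = cech_of_koszul p k c \<longleftrightarrow>
     (\<exists>l. \<forall>I\<in>index_sets p. raise_level l b I = raise_level l c I)"
proof
  assume eq: "cech_of_koszul p k b = cech_of_koszul p k c"
  have "\<exists>l. scale (prod x I ^ (l + k)) (b I) = scale (prod x I ^ (l + k)) (c I)"
    if "I \<in> index_sets p" for I
    using fun_cong[OF eq, of I] that unfolding cech_of_koszul_def by (simp add: loc_frac_eq_iff)
  then obtain l where l: "\<And>I. I \<in> index_sets p \<Longrightarrow>
      scale (prod x I ^ (l I + k)) (b I) = scale (prod x I ^ (l I + k)) (c I)"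
    by metis
  obtain L where L: "\<And>I. I \<in> index_sets p \<Longrightarrow> l I + k \<le> L"
    using finite_imageI[OF finite_index_sets, of "\<lambda>I. l I + k" p]
    unfolding finite_nat_set_iff_bounded_le by auto
  have "raise_level L b I = raise_level L c I" if "I \<in> index_sets p" for I
    using scale_power_shift[OF l[OF that], of "L - (l I + k)"] L[OF that]
    unfolding raise_level_def by simp
  then show "\<exists>l. \<forall>I\<in>index_sets p. raise_level l b I = raise_level l c I"
    by blast
next
  assume "\<exists>l. \<forall>I\<in>index_sets p. raise_level l b I = raise_level l c I"
  then obtain l where "\<And>I. I \<in> index_sets p \<Longrightarrow> raise_level l b I = raise_level l c I"
    by blast
  then have "cech_of_koszul p (k + l) (raise_level l b) = cech_of_koszul p (k + l) (raise_level l c)"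
    by (rule cech_of_koszul_cong)
  then show "cech_of_koszul p k b = cech_of_koszul p k c"
    unfolding cech_of_koszul_raise_level .
qed

text \<open>Finitely many fractions have a common denominator exponent \<open>K\<close>; the missing
  powers are multiplied into the numerators, whose degrees change accordingly.\<close>

lemma mem_cech_cochains:
  "d \<in> cech_cochains scale M x n p t \<longleftrightarrow>
     (\<exists>k. \<exists>c\<in>koszul_cochains (int p) k t. d = cech_of_koszul (int p) k c)"
proof
  assume d: "d \<in> cech_cochains scale M x n p t"
  have "\<exists>m k. d I = loc_frac scale (prod x I) m k \<and> m \<in> M (t + int k * int p)"
    if "I \<in> index_sets (int p)" for I
    using d that unfolding cech_cochains_def cech_index_eq loc_degree_def by blast
  then obtain m k where mk: "\<And>I. I \<in> index_sets (int p) \<Longrightarrow>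
      d I = loc_frac scale (prod x I) (m I) (k I) \<and> m I \<in> M (t + int (k I) * int p)"
    by metis
  obtain K where K: "\<And>I. I \<in> index_sets (int p) \<Longrightarrow> k I \<le> K"
    using finite_imageI[OF finite_index_sets, of k "int p"]
    unfolding finite_nat_set_iff_bounded_le by auto
  define c where "c I = scale (prod x I ^ (K - k I)) (m I)" for I
  have "c \<in> koszul_cochains (int p) K t"
    unfolding koszul_cochains_def c_def
  proof (intro CollectI ballI)
    fix I assume I: "I \<in> index_sets (int p)"
    have "t + int K * int p = int (nat (int p) * (K - k I)) + (t + int (k I) * int p)"
      using K[OF I] by (simp add: algebra_simps of_nat_diff)
    then show "scale (prod x I ^ (K - k I)) (m I) \<in> M (t + int K * int p)"
      using mk[OF I] by (intro scale_int_mem[OF x_prod_power_mem[OF I]]) auto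
  qed
  moreover have "d = cech_of_koszul (int p) K c"
    unfolding cech_of_koszul_def
  proof (rule extensionalityI[of _ "index_sets (int p)"])
    show "d \<in> extensional (index_sets (int p))"
      using d unfolding cech_cochains_def cech_index_eq by (simp add: PiE_iff)
    fix I assume I: "I \<in> index_sets (int p)"
    show "d I = (\<lambda>I\<in>index_sets (int p). loc_frac scale (prod x I) (c I) K) I"
      using loc_frac_raise[of "prod x I" "K - k I" "m I" "k I"] mk[OF I] K[OF I] I
      by (simp add: c_def)
  qed simp
  ultimately show "\<exists>k. \<exists>c\<in>koszul_cochains (int p) k t. d = cech_of_koszul (int p) k c"
    by blast
next
  assume "\<exists>k. \<exists>c\<in>koszul_cochains (int p) k t. d = cech_of_koszul (int p) k c"
  then obtain k c where c: "c \<in> koszul_cochains (int p) k t" "d = cech_of_koszul (int p) k c"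
    by blast
  show "d \<in> cech_cochains scale M x n p t"
    unfolding c(2) cech_cochains_def cech_index_eq cech_of_koszul_def loc_degree_def
    using c(1) unfolding koszul_cochains_def by auto
qed

lemma cech_zero_eq: "cech_zero scale x n p = cech_of_koszul (int p) k (\<lambda>_. 0)"
  unfolding cech_zero_def cech_of_koszul_def cech_index_eq localization_zero[of _ k] ..

lemma cech_diff_cech_of_koszul:
  "cech_diff scale x n p (cech_of_koszul (int p) k c) = cech_of_koszul (int (p + 1)) k (koszul_diff k c)"
  unfolding cech_diff_def cech_of_koszul_def cech_index_eq
proof (rule restrict_ext)
  fix J assume J: "J \<in> index_sets (int (p + 1))"
  interpret loc: abelian_monoid "localization scale (prod x J)"
    by (rule abelian_monoid_localization)
  let ?c = "\<lambda>I\<in>index_sets (int p). loc_frac scale (prod x I) (c I) k"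
  have "(- 1) ^ card {i \<in> J. i < j} \<odot>\<^bsub>localization scale (prod x J)\<^esub>
      loc_map scale (prod x (J - {j})) (x j) (?c (J - {j})) =
    loc_frac scale (prod x J) (scale (koszul_sign J j * x j ^ k) (c (J - {j}))) k" if j: "j \<in> J" for j
  proof -
    have "J - {j} \<in> index_sets (int p)"
      using index_sets_remove[OF J j] by simp
    moreover have "prod x (J - {j}) * x j = prod x J"
      using prod.remove[OF finite_index[OF J] j, of x] by (simp add: mult.commute)
    ultimately show ?thesis
      by (simp add: loc_map_loc_frac localization_smult koszul_sign_def)
  qed
  then have "(\<Oplus>\<^bsub>localization scale (prod x J)\<^esub>j\<in>J.
      (- 1) ^ card {i \<in> J. i < j} \<odot>\<^bsub>localization scale (prod x J)\<^esub>
      loc_map scale (prod x (J - {j})) (x j) (?c (J - {j}))) =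
    (\<Oplus>\<^bsub>localization scale (prod x J)\<^esub>j\<in>J.
      loc_frac scale (prod x J) (scale (koszul_sign J j * x j ^ k) (c (J - {j}))) k)"
    by (intro loc.finsum_cong') (auto intro: localization_carrier)
  also have "\<dots> = loc_frac scale (prod x J) (koszul_diff k c J) k"
    unfolding localization_finsum[OF finite_index[OF J]] koszul_diff_def ..
  finally show "(\<Oplus>\<^bsub>localization scale (prod x J)\<^esub>j\<in>J.
      (- 1) ^ card {i \<in> J. i < j} \<odot>\<^bsub>localization scale (prod x J)\<^esub>
      loc_map scale (prod x (J - {j})) (x j) (?c (J - {j}))) =
    loc_frac scale (prod x J) (koszul_diff k c J) k" .
qed

text \<open>For \<open>p = 0\<close> the right-hand side also yields only the zero cochain, because
  the differential at the empty set is an empty sum whatever \<open>b\<close> is.\<close>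

lemma mem_cech_coboundaries:
  "d \<in> cech_coboundaries scale M x n p t \<longleftrightarrow>
     (\<exists>k. \<exists>b\<in>koszul_cochains (int p - 1) k t. d = cech_of_koszul (int p) k (koszul_diff k b))"
proof (cases p)
  case 0
  have "cech_of_koszul 0 k (koszul_diff k b) = cech_zero scale x n 0" for k b
    unfolding cech_zero_eq[of 0 k] of_nat_0
  proof (rule cech_of_koszul_cong)
    fix I assume I: "I \<in> index_sets 0"
    then have "card I = 0"
      unfolding index_sets_def by simp
    then have "I = {}"
      using finite_index[OF I] by simp
    then show "koszul_diff k b I = 0"
      by (simp add: koszul_diff_def)
  qed
  moreover have "cech_coboundaries scale M x n p t = {cech_zero scale x n 0}"
    by (simp add: 0 cech_coboundaries_def)
  ultimately show ?thesis
    using koszul_cochains_zero unfolding 0 of_nat_0 by (metis singleton_iff)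
next
  case (Suc q)
  have "cech_coboundaries scale M x n p t = cech_diff scale x n q ` cech_cochains scale M x n q t"
    by (simp add: Suc cech_coboundaries_def)
  then have "d \<in> cech_coboundaries scale M x n p t \<longleftrightarrow>
    (\<exists>c\<in>cech_cochains scale M x n q t. d = cech_diff scale x n q c)"
    by blast
  also have "\<dots> \<longleftrightarrow>
    (\<exists>k. \<exists>b\<in>koszul_cochains (int q) k t. d = cech_diff scale x n q (cech_of_koszul (int q) k b))"
    unfolding Bex_def mem_cech_cochains by blast
  finally show ?thesis
    unfolding cech_diff_cech_of_koszul by (simp add: Suc)
qed

lemma cech_of_koszul_cocycle_iff:
  assumes "c \<in> koszul_cochains (int p) k t"
  shows "cech_of_koszul (int p) k c \<in> cech_cocycles scale M x n p t \<longleftrightarrow>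
    (\<exists>l. koszul_cocycle {0} (int p) (k + l) (raise_level l c))"
proof -
  have "cech_of_koszul (int p) k c \<in> cech_cocycles scale M x n p t \<longleftrightarrow>
    cech_of_koszul (int (p + 1)) k (koszul_diff k c) = cech_of_koszul (int (p + 1)) k (\<lambda>_. 0)"
    unfolding cech_cocycles_def mem_cech_cochains cech_zero_eq[of _ k] mem_Collect_eq
      cech_diff_cech_of_koszul using assms by blast
  also have "\<dots> \<longleftrightarrow> (\<exists>l. \<forall>J\<in>index_sets (int p + 1). koszul_diff (k + l) (raise_level l c) J = 0)"
    unfolding cech_of_koszul_eq_iff of_nat_add of_nat_1
    using raise_level_koszul_diff[OF finite_index] by (simp add: raise_level_def[of _ "\<lambda>_. 0"])
  finally show ?thesis
    unfolding koszul_cocycle_def by simp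
qed

lemma cech_of_koszul_coboundary_iff:
  "cech_of_koszul (int p) k c \<in> cech_coboundaries scale M x n p t \<longleftrightarrow>
     koszul_coboundary {0} (int p) k t c"
proof
  assume "cech_of_koszul (int p) k c \<in> cech_coboundaries scale M x n p t"
  then obtain k' b where b: "b \<in> koszul_cochains (int p - 1) k' t"
    and eq: "cech_of_koszul (int p) k c = cech_of_koszul (int p) k' (koszul_diff k' b)"
    unfolding mem_cech_coboundaries by blast
  \<comment> \<open>The two sides come with different levels \<open>k\<close> and \<open>k'\<close>;
    numerators can be compared only over the common level \<open>k + k'\<close>.\<close>
  have "cech_of_koszul (int p) (k + k') (raise_level k' c) =
    cech_of_koszul (int p) (k' + k) (raise_level k (koszul_diff k' b))"
    unfolding cech_of_koszul_raise_level eq ..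
  then obtain l where l: "\<And>I. I \<in> index_sets (int p) \<Longrightarrow>
    raise_level l (raise_level k' c) I = raise_level l (raise_level k (koszul_diff k' b)) I"
    unfolding add.commute[of k' k] cech_of_koszul_eq_iff by blast
  have "raise_level (k' + l) c I - koszul_diff (k + (k' + l)) (raise_level (k + l) b) I \<in> {0}"
    if "I \<in> index_sets (int p)" for I
    using l[OF that] raise_level_koszul_diff[OF finite_index[OF that], of "k + l" k' b]
    unfolding raise_level_raise_level by (simp add: add_ac)
  moreover have "raise_level (k + l) b \<in> koszul_cochains (int p - 1) (k + (k' + l)) t"
    using raise_level_mem[OF b, of "k + l"] by (simp add: add_ac)
  ultimately show "koszul_coboundary {0} (int p) k t c"
    unfolding koszul_coboundary_def by blast
next
  assume "koszul_coboundary {0} (int p) k t c"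
  then obtain l b where b: "b \<in> koszul_cochains (int p - 1) (k + l) t"
    "\<And>I. I \<in> index_sets (int p) \<Longrightarrow> raise_level l c I = koszul_diff (k + l) b I"
    unfolding koszul_coboundary_def by auto
  have "cech_of_koszul (int p) k c = cech_of_koszul (int p) (k + l) (koszul_diff (k + l) b)"
    unfolding cech_of_koszul_raise_level[of _ k l c, symmetric]
    using b(2) by (rule cech_of_koszul_cong)
  then show "cech_of_koszul (int p) k c \<in> cech_coboundaries scale M x n p t"
    unfolding mem_cech_coboundaries using b(1) by blast
qed

lemma cech_cohomology_vanishes_iff:
  "cech_cocycles scale M x n p t = cech_coboundaries scale M x n p t \<longleftrightarrow>
     cohomology_vanishes {0} (int p) t"
proof
  assume eq: "cech_cocycles scale M x n p t = cech_coboundaries scale M x n p t"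
  show "cohomology_vanishes {0} (int p) t"
    unfolding cohomology_vanishes_def
  proof (intro allI ballI impI)
    fix k c assume c: "c \<in> koszul_cochains (int p) k t" "koszul_cocycle {0} (int p) k c"
    then have "koszul_cocycle {0} (int p) (k + 0) (raise_level 0 c)"
      by (simp add: raise_level_0)
    then have "cech_of_koszul (int p) k c \<in> cech_coboundaries scale M x n p t"
      unfolding eq[symmetric] cech_of_koszul_cocycle_iff[OF c(1)] by blast
    then show "koszul_coboundary {0} (int p) k t c"
      unfolding cech_of_koszul_coboundary_iff .
  qed
next
  assume van: "cohomology_vanishes {0} (int p) t"
  show "cech_cocycles scale M x n p t = cech_coboundaries scale M x n p t"
  proof (intro subset_antisym subsetI)
    fix d assume d: "d \<in> cech_cocycles scale M x n p t"
    then obtain k c where c: "c \<in> koszul_cochains (int p) k t" "d = cech_of_koszul (int p) k c"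
      unfolding cech_cocycles_def using mem_cech_cochains by blast
    obtain l where "koszul_cocycle {0} (int p) (k + l) (raise_level l c)"
      using d unfolding c(2) cech_of_koszul_cocycle_iff[OF c(1)] by blast
    then have "koszul_coboundary {0} (int p) (k + l) t (raise_level l c)"
      using van raise_level_mem[OF c(1), of l] unfolding cohomology_vanishes_def by blast
    then show "d \<in> cech_coboundaries scale M x n p t"
      unfolding cech_of_koszul_coboundary_iff[symmetric] cech_of_koszul_raise_level c(2) .
  next
    fix d assume "d \<in> cech_coboundaries scale M x n p t"
    then obtain k b where b: "b \<in> koszul_cochains (int p - 1) k t"
      "d = cech_of_koszul (int p) k (koszul_diff k b)"
      unfolding mem_cech_coboundaries by blast
    have "koszul_diff k b \<in> koszul_cochains (int p) k t"
      using koszul_diff_mem[OF b(1)] by simp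
    moreover have "koszul_cocycle {0} (int p) (k + 0) (raise_level 0 (koszul_diff k b))"
      unfolding koszul_cocycle_def raise_level_0 using koszul_diff_koszul_diff[OF finite_index] by simp
    ultimately show "d \<in> cech_cocycles scale M x n p t"
      unfolding b(2) using cech_of_koszul_cocycle_iff by blast
  qed
qed

end

section \<open>Regularity via filter-regular sequences\<close>

lemma a_inv_le_iff: "a_inv U V \<le> ereal r \<longleftrightarrow> (\<forall>t. r < of_int t \<longrightarrow> U t = V t)"
  unfolding a_inv_def SUP_le_iff by (auto simp: not_le[symmetric])

lemma a_quot_le_iff:
  assumes "N \<subseteq> L"
  shows "a_quot M L N \<le> ereal r \<longleftrightarrow> (\<forall>t. r < of_int t \<longrightarrow> L \<inter> M t \<subseteq> N)"
  unfolding a_quot_def a_inv_le_iff using assms by blast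

text \<open>Real upper bounds determine an extended real, including the infinite values; thus the
  suprema in the theorem can be compared through statements about integer degrees only.\<close>

lemma ereal_eqI_upper_bounds:
  assumes "\<And>r. a \<le> ereal r \<longleftrightarrow> b \<le> ereal r"
  shows "a = b"
  using assms by (metis antisym ereal_le_real)

context graded_module_linear_forms
begin

lemma reg_le_iff: "reg scale M x n \<le> ereal r \<longleftrightarrow> reg_le {0} r"
proof -
  have "a + ereal (real i) \<le> ereal r \<longleftrightarrow> a \<le> ereal (r - real i)" for a i
    by (cases a) auto
  then have "reg scale M x n \<le> ereal r \<longleftrightarrow>
    (\<forall>i t. r < of_int (t + int i) \<longrightarrow> cohomology_vanishes {0} (int i) t)"
    unfolding reg_def SUP_le_iff a_local_cohomology_def
    by (simp add: a_inv_le_iff cech_cohomology_vanishes_iff diff_less_eq)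
  also have "\<dots> \<longleftrightarrow> reg_le {0} r"
    \<comment> \<open>Regularity ranges over natural cohomological degrees and \<open>reg_le\<close>
      over integers; the negative ones are vacuous.\<close>
    unfolding reg_le_def using cohomology_vanishes_negative
    by (metis linorder_not_less nonneg_int_cases)
  finally show ?thesis .
qed

lemma reg_le_add_multiples_iff:
  assumes N: "homogeneous N" and z: "z \<in> R 1" and filter: "filter_regular_quot R scale M N z"
  shows "reg_le N r \<longleftrightarrow>
    (\<forall>t. r < of_int t \<longrightarrow> colon_elem scale N z \<inter> M t \<subseteq> N) \<and> reg_le (add_multiples z N) r"
proof -
  have sub: "subspace N"
    using N unfolding homogeneous_def by blast
  obtain t0 where t0: "\<And>u t. t0 \<le> t \<Longrightarrow> u \<in> M t \<Longrightarrow> scale z u \<in> N \<Longrightarrow> u \<in> N"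
    using filter unfolding filter_regular_quot_def colon_elem_def by blast
  show ?thesis
  proof (intro iffI conjI allI impI; (elim conjE)?)
    assume "reg_le N r"
    then show "reg_le (add_multiples z N) r"
      using reg_le_quotient[OF N z] t0 by blast
    show "colon_elem scale N z \<inter> M t \<subseteq> N" if "r < of_int t" for t
      using colon_le_if_reg_le[OF sub, of t0 z r t] t0 \<open>reg_le N r\<close> that
      unfolding colon_elem_def by blast
  next
    assume "\<forall>t. r < of_int t \<longrightarrow> colon_elem scale N z \<inter> M t \<subseteq> N" "reg_le (add_multiples z N) r"
    then show "reg_le N r"
      using reg_le_if_quotient[OF N z, of r] unfolding colon_elem_def by blast
  qed
qed

lemma reg_le_QM_iff:
  assumes "\<forall>i\<in>{1..s}. z i \<in> R 1" "filter_regular_seq R scale M z s"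
  shows "reg_le {0} r \<longleftrightarrow>
    (\<forall>i<s. \<forall>t. r < of_int t \<longrightarrow> colon_elem scale (QM scale z i) (z (i + 1)) \<inter> M t \<subseteq> QM scale z i) \<and>
    reg_le (QM scale z s) r"
  using assms
proof (induction s)
  case (Suc s)
  then have "reg_le (QM scale z s) r \<longleftrightarrow>
    (\<forall>t. r < of_int t \<longrightarrow> colon_elem scale (QM scale z s) (z (s + 1)) \<inter> M t \<subseteq> QM scale z s) \<and>
    reg_le (QM scale z (Suc s)) r"
    unfolding Suc_eq_plus1[symmetric] QM_Suc
    by (intro reg_le_add_multiples_iff homogeneous_QM) (auto simp: filter_regular_seq_def)
  moreover have "\<forall>i\<in>{1..s}. z i \<in> R 1" "filter_regular_seq R scale M z s"
    using Suc.prems by (simp_all add: filter_regular_seq_def)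
  note Suc.IH[OF this]
  ultimately show ?case
    unfolding All_less_Suc by blast
qed (simp add: QM_0)

text \<open>Descending induction on the degree: in degrees beyond \<open>t\<close>, multiplication by \<open>R\<^sub>+\<close> lands in \<open>N\<close>.\<close>

lemma socle_detects_top_degree:
  fixes r :: real
  assumes N: "subspace N" and L: "subspace L" and top: "\<And>t. t0 \<le> t \<Longrightarrow> L \<inter> M t \<subseteq> N"
    and socle: "\<And>t. r < of_int t \<Longrightarrow> colon_ideal scale N (ideal_gen (x ` {..<n})) \<inter> M t \<subseteq> N"
    and t: "r < of_int t"
  shows "L \<inter> M t \<subseteq> N"
  using t
proof (induction "nat (t0 - t)" arbitrary: t)
  case 0
  then show ?case
    using top by simp
next
  case (Suc d)
  interpret ring: Modules.module "(*) :: 'r \<Rightarrow> 'r \<Rightarrow> 'r"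
    by unfold_locales (auto simp: algebra_simps)
  show ?case
  proof
    fix u assume u: "u \<in> L \<inter> M t"
    have "d = nat (t0 - (t + 1))" "r < of_int (t + 1)"
      using Suc.hyps(2) Suc.prems by auto
    then have "L \<inter> M (t + 1) \<subseteq> N"
      by (rule Suc.hyps(1))
    moreover have "scale (x j) u \<in> L \<inter> M (t + 1)" if "j < n" for j
      using scale_mem[OF x_linear[OF that], of u t] u subspace_scale[OF L] by (simp add: add.commute)
    ultimately have xu: "scale (x j) u \<in> N" if "j < n" for j
      using that by blast
    have "scale f u \<in> N" if "f \<in> ideal_gen (x ` {..<n})" for f
      using that unfolding ideal_gen_def
    proof (induction rule: ring.span_induct_alt)
      case base
      then show ?case using subspace_0[OF N] by simp
    next
      case (step c y w)
      then have "scale y u \<in> N"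
        using xu by auto
      then have "scale c (scale y u) \<in> N"
        by (rule subspace_scale[OF N])
      then show ?case
        using step subspace_add[OF N] by (simp add: scale_left_distrib)
    qed
    then show "u \<in> N"
      using socle[OF Suc.prems] u unfolding colon_ideal_def by blast
  qed
qed

lemma subspace_colon_elem:
  assumes "subspace N"
  shows "subspace (colon_elem scale N z)"
  unfolding colon_elem_def
proof (rule subspaceI)
  fix c u assume "u \<in> {e. scale z e \<in> N}"
  then have "scale c (scale z u) \<in> N"
    using subspace_scale[OF assms] by blast
  then show "scale c u \<in> {e. scale z e \<in> N}"
    by (simp add: mult.commute)
qed (use subspace_0[OF assms] subspace_add[OF assms] in \<open>auto simp: scale_right_distrib\<close>)

end

theorem theorem2p4:
  fixes R :: "nat \<Rightarrow> 'r::comm_ring_1 set"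
    and scale :: "'r \<Rightarrow> 'm::ab_group_add \<Rightarrow> 'm"
    and M :: "int \<Rightarrow> 'm set"
    and x :: "nat \<Rightarrow> 'r" and n :: nat
    and z :: "nat \<Rightarrow> 'r" and s :: nat
  assumes "graded_module R scale M"
    and "noetherian_degree_zero R"
    and "fin_gen_algebra R"
    and "standard_graded R"
    and "fin_gen_module scale"
    and x_linear: "\<forall>i<n. x i \<in> R 1"
    and x_generate: "ideal_gen (x ` {..<n}) = irrelevant_ideal R"
    and "\<forall>i\<in>{1..s}. z i \<in> R 1"
    and "filter_regular_seq R scale M z s"
    and "is_reduction R scale M (ideal_gen (z ` {1..s}))"
  shows "reg scale M x n = max (a_seq scale M z s) (a_quot M UNIV (QM scale z s)) \<and>
         max (a_seq scale M z s) (a_quot M UNIV (QM scale z s)) =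
           (SUP i\<in>{0..s}. a_quot M (colon_ideal scale (QM scale z i) (irrelevant_ideal R))
                                    (QM scale z i))"
proof -
  interpret graded_module R scale M by fact
  have R1: "R 1 \<subseteq> irrelevant_ideal R"
  proof
    fix a assume "a \<in> R 1"
    then have "a = (\<Sum>i\<in>{1}. a) \<and> finite {1::nat} \<and> {1} \<subseteq> {1::nat..} \<and> (\<forall>i\<in>{1}. a \<in> R i)"
      by simp
    then show "a \<in> irrelevant_ideal R"
      unfolding irrelevant_ideal_def sum_of_family_def by blast
  qed
  interpret graded_module_linear_forms R scale M x n
    by unfold_locales (use x_linear x_generate R1 in auto)
  let ?N = "QM scale z" and ?J = "ideal_gen (x ` {..<n})"
  note z = assms(8) and filter = assms(9)
  have hom: "homogeneous (?N i)" if "i \<le> s" for i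
    using homogeneous_QM z that by simp
  then have sub: "subspace (?N i)" if "i \<le> s" for i
    using that unfolding homogeneous_def by blast
  have N_elem: "?N i \<subseteq> colon_elem scale (?N i) a" if "i \<le> s" for i a
    unfolding colon_elem_def using subspace_scale[OF sub[OF that]] by blast
  have N_ideal: "?N i \<subseteq> colon_ideal scale (?N i) ?J" if "i \<le> s" for i
    unfolding colon_ideal_def using subspace_scale[OF sub[OF that]] by blast
  obtain t0 where t0: "\<And>t. t0 \<le> t \<Longrightarrow> M t \<subseteq> ?N s"
    using assms(10) unfolding is_reduction_def QM_def by blast
  have a_seq: "a_seq scale M z s \<le> ereal r \<longleftrightarrow>
    (\<forall>i<s. \<forall>t. r < of_int t \<longrightarrow> colon_elem scale (?N i) (z (i + 1)) \<inter> M t \<subseteq> ?N i)" for r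
    unfolding a_seq_def SUP_le_iff using a_quot_le_iff[OF N_elem] by (simp add: Ball_def)
  have a_top: "a_quot M UNIV (?N s) \<le> ereal r \<longleftrightarrow> (\<forall>t. r < of_int t \<longrightarrow> M t \<subseteq> ?N s)" for r
    using a_quot_le_iff[OF subset_UNIV] by simp
  have socle: "(SUP i\<in>{0..s}. a_quot M (colon_ideal scale (?N i) ?J) (?N i)) \<le> ereal r \<longleftrightarrow>
    (\<forall>i\<le>s. \<forall>t. r < of_int t \<longrightarrow> colon_ideal scale (?N i) ?J \<inter> M t \<subseteq> ?N i)" for r
    unfolding SUP_le_iff using a_quot_le_iff[OF N_ideal] by (simp add: Ball_def)
  have "reg scale M x n = max (a_seq scale M z s) (a_quot M UNIV (?N s))"
    by (rule ereal_eqI_upper_bounds)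
      (simp add: reg_le_iff reg_le_QM_iff[OF z filter] a_seq a_top reg_le_torsion[OF sub t0])
  moreover have "max (a_seq scale M z s) (a_quot M UNIV (?N s)) =
    (SUP i\<in>{0..s}. a_quot M (colon_ideal scale (?N i) ?J) (?N i))"
  proof (rule ereal_eqI_upper_bounds)
    fix r :: real
    have "(\<forall>i<s. \<forall>t. r < of_int t \<longrightarrow> colon_elem scale (?N i) (z (i + 1)) \<inter> M t \<subseteq> ?N i) \<and>
        (\<forall>t. r < of_int t \<longrightarrow> M t \<subseteq> ?N s) \<longleftrightarrow>
      (\<forall>i\<le>s. \<forall>t. r < of_int t \<longrightarrow> colon_ideal scale (?N i) ?J \<inter> M t \<subseteq> ?N i)" (is "?A \<and> ?B \<longleftrightarrow> ?C")
    proof (intro iffI conjI)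
      assume AB: "?A \<and> ?B"
      show ?C
      proof (intro allI impI)
        fix i t assume i: "i \<le> s" and t: "r < of_int t"
        show "colon_ideal scale (?N i) ?J \<inter> M t \<subseteq> ?N i"
        proof (cases "i < s")
          case True
          \<comment> \<open>Being annihilated by R_+ modulo \<open>?N i\<close> is stronger than
            being annihilated by the single element \<open>z (i + 1)\<close>.\<close>
          then have "z (i + 1) \<in> ?J"
            using z x_generate by auto
          then have "colon_ideal scale (?N i) ?J \<subseteq> colon_elem scale (?N i) (z (i + 1))"
            unfolding colon_ideal_def colon_elem_def by blast
          then show ?thesis
            using AB True t by blast
        next
          \<comment> \<open>For \<open>i = s\<close> no further element of the sequence is
            available, and the bound on M/QM takes its place.\<close>
          case False
          then show ?thesis
            using AB i t by auto
        qed
      qed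
    next
      assume C: ?C
      have N_socle: "colon_ideal scale (?N i) ?J \<inter> M t \<subseteq> ?N i" if "i \<le> s" "r < of_int t" for i t
        using C that by blast
      show ?B
      proof (intro allI impI)
        fix t assume t: "r < of_int t"
        \<comment> \<open>The descent needs a degree to start from: here the reduction property
          supplies it, and for the colon submodules below filter-regularity does.\<close>
        have "UNIV \<inter> M t \<subseteq> ?N s" if "t0 \<le> t" for t
          using t0[OF that] by blast
        then have "UNIV \<inter> M t \<subseteq> ?N s"
          by (rule socle_detects_top_degree[OF sub[OF order_refl] subspace_UNIV _ N_socle[OF order_refl] t])
        then show "M t \<subseteq> ?N s"
          by simp
      qed
      show ?A
      proof (intro allI impI)
        fix i t assume i: "i < s" and t: "r < of_int t"
        obtain t1 where "\<And>t. t1 \<le> t \<Longrightarrow> colon_elem scale (?N i) (z (i + 1)) \<inter> M t \<subseteq> ?N i"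
          using filter i unfolding filter_regular_seq_def filter_regular_quot_def by blast
        moreover have "i \<le> s"
          using i by simp
        note socle_detects_top_degree[OF sub[OF this] subspace_colon_elem[OF sub[OF this]] _ N_socle[OF this] t]
        ultimately show "colon_elem scale (?N i) (z (i + 1)) \<inter> M t \<subseteq> ?N i"
          by blast
      qed
    qed
    then show "max (a_seq scale M z s) (a_quot M UNIV (?N s)) \<le> ereal r \<longleftrightarrow>
      (SUP i\<in>{0..s}. a_quot M (colon_ideal scale (?N i) ?J) (?N i)) \<le> ereal r"
      unfolding max.bounded_iff a_seq a_top socle .
  qed
  ultimately show ?thesis
    unfolding assms(7) by (rule conjI)
qed

end
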